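(* Let $\sigma$ be a weakly mixing m.p. action of a countable discrete group $\Gamma$ on a standard probability space $(X,\mu)$, and let $\tilde\sigma$ be the double action $\tilde\sigma_g(t_1,t_2)=(gt_1,gt_2)$ on $(X\times X,\mu\times\mu)$. Let $\rho$ be another m.p. action of $\Gamma$ on a standard probability space $(Y,\nu)$. Let $\mathcal V$ be a Polish group of finite type and let $w$ be a $\mathcal V$-valued measurable cocycle for the diagonal product action $\sigma\times\rho$ on $(X\times Y,\mu\times\nu)$. Denote by $w^l,w^r$ the cocycles for the diagonal product action $\tilde\sigma\times\rho$ on $X\times X\times Y$ defined by $$w^l(t_1,t_2,s,g)=w(t_1,s,g),\qquad w^r(t_1,t_2,s,g)=w(t_2,s,g),\qquad g\in\Gamma,\ t_1,t_2\in X,\ s\in Y.$$ Assume there exists a separable finite von Neumann algebra $(N,\tau)$ such that $\mathcal V$ can be realized as a closed subgroup of $\mathcal U(N)$ and such that $w^l\sim w^r$ as $\mathcal U(N)$-valued cocycles for $\tilde\sigma\times\rho$. Then $w$ is equivalent (as a $\mathcal V$-valued cocycle for $\sigma\times\rho$) to a $\mathcal V$-valued cocycle which is independent of the $X$-variable. Conversely, if $w\in Z^1(\sigma\times\rho;\mathcal V)$ is equivalent to a cocycle in $Z^1(\rho;\mathcal V)$, then $w^l\sim w^r$ in $Z^1(\tilde\sigma\times\rho;\mathcal V)$. In particular, if $w\in Z^1(\sigma;\mathcal V)$, then $w$ is equivalent to a group morphism $\Gamma\to\mathcal V$ if and only if $w^l\sim w^r$ in $Z^1(\tilde\sigma;\mathcal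 V)$, where $w^l(t_1,t_2,g)=w(t_1,g)$, $w^r(t_1,t_2,g)=w(t_2,g)$, $t_1,t_2\in X$, $g\in\Gamma$.
   Context: **Cocycles.** For a m.p. action $\sigma$ of $\Gamma$ on $(X,\mu)$ and a Polish group $\mathcal V$, $Z^1(\sigma;\mathcal V)$ is the set of (right) measurable cocycles, i.e. measurable maps $w:X\times\Gamma\to\mathcal V$ such that for all $g_1,g_2\in\Gamma$, $w(t,g_1)\,w(g_1^{-1}t,g_2)=w(t,g_1g_2)$ for a.e. $t\in X$. Two cocycles are equivalent (cohomologous), $w\sim w'$, if there is a measurable $u:X\to\mathcal V$ such that for each $g\in\Gamma$, $w'(t,g)=u(t)^{-1}w(t,g)u(g^{-1}t)$ for a.e. $t$. Group morphisms are identified with cocycles not depending on $t$; cocycles for $\rho$ are viewed as cocycles for $\sigma\times\rho$ not depending on the $X$-variable. **Finite type.** A Polish group is of finite type if it is isomorphic (as a Polish group) to a closed subgroup of the unitary group $\mathcal U(N)$ (with the $\|\cdot\|_2$-topology) of a separable finite von Neumann algebra $N$, i.e. one with a faithful normal trace state $\tau$ and separable in $\|x\|_2=\tau(x^*x)^{1/2}$. *)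

theory Defs
  imports "HOL-Probability.Probability" "HOL-Algebra.Group_Action"
begin

section \<open>Polish groups\<close>

definition polish_topology :: "'a topology \<Rightarrow> bool" where
  "polish_topology T \<longleftrightarrow> completely_metrizable_space T \<and> second_countable T"

definition borel_of_topology :: "'a topology \<Rightarrow> 'a measure" where
  "borel_of_topology T = sigma (topspace T) {U. openin T U}"

definition polish_group :: "('v, 'm) monoid_scheme \<Rightarrow> 'v topology \<Rightarrow> bool" where
  "polish_group V T \<longleftrightarrow>
     group V \<and> topspace T = carrier V \<and> polish_topology T \<and>
     continuous_map (prod_topology T T) T (\<lambda>(x, y). x \<otimes>\<^bsub>V\<^esub> y) \<and>
     continuous_map T T (\<lambda>x. inv\<^bsub>V\<^esub> x)"

text \<open>
  The isomorphisms of the Polish group \<open>(V, T)\<close> onto a closed subgroup of the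
  topological group \<open>(U, S)\<close>.
\<close>

definition closed_embedding ::
  "('v, 'm) monoid_scheme \<Rightarrow> 'v topology \<Rightarrow> ('u, 'n) monoid_scheme \<Rightarrow> 'u topology \<Rightarrow> ('v \<Rightarrow> 'u) set"
  where
  "closed_embedding V T U S =
     {\<phi> \<in> hom V U. embedding_map T S \<phi> \<and> closedin S (\<phi> ` carrier V)}"


section \<open>Finite von Neumann algebras\<close>

text \<open>
  The inner product is linear in its first argument. The underlying real inner product,
  hence norm and topology, is that of \<^class>\<open>real_inner\<close>.
\<close>

class complex_hilbert = real_inner + complete_space +
  fixes scaleC :: "complex \<Rightarrow> 'a \<Rightarrow> 'a" (infixr \<open>*\<^sub>C\<close> 75)
    and cinner :: "'a \<Rightarrow> 'a \<Rightarrow> complex"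
  assumes scaleC_add_right: "c *\<^sub>C (x + y) = c *\<^sub>C x + c *\<^sub>C y"
    and scaleC_add_left: "(c + d) *\<^sub>C x = c *\<^sub>C x + d *\<^sub>C x"
    and scaleC_scaleC: "c *\<^sub>C d *\<^sub>C x = (c * d) *\<^sub>C x"
    and scaleC_of_real: "complex_of_real r *\<^sub>C x = r *\<^sub>R x"
    and cinner_add_left: "cinner (x + y) z = cinner x z + cinner y z"
    and cinner_scaleC_left: "cinner (c *\<^sub>C x) y = c * cinner x y"
    and cinner_commute: "cinner x y = cnj (cinner y x)"
    and Re_cinner: "Re (cinner x y) = inner x y"

instantiation complex :: complex_hilbert
begin

definition scaleC_complex :: "complex \<Rightarrow> complex \<Rightarrow> complex" where
  "scaleC_complex c x = c * x"

definition cinner_complex :: "complex \<Rightarrow> complex \<Rightarrow> complex" where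
  "cinner_complex x y = x * cnj y"

instance
  by standard
    (simp_all add: scaleC_complex_def cinner_complex_def algebra_simps scaleR_conv_of_real inner_complex_def)

end

text \<open>
  The type \<open>'h \<Rightarrow>\<^sub>L 'h\<close> consists of the bounded real-linear operators on \<open>'h\<close>;
  \<open>B(H)\<close> is the subset of the complex-linear ones.
\<close>

definition bounded_ops :: "('h::complex_hilbert \<Rightarrow>\<^sub>L 'h) set" where
  "bounded_ops = {T. \<forall>c x. blinfun_apply T (c *\<^sub>C x) = c *\<^sub>C blinfun_apply T x}"

definition scaleC_op :: "complex \<Rightarrow> ('h::complex_hilbert \<Rightarrow>\<^sub>L 'h) \<Rightarrow> ('h \<Rightarrow>\<^sub>L 'h)" where
  "scaleC_op c T = Blinfun (\<lambda>x. c *\<^sub>C blinfun_apply T x)"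

definition is_adjoint :: "('h::complex_hilbert \<Rightarrow>\<^sub>L 'h) \<Rightarrow> ('h \<Rightarrow>\<^sub>L 'h) \<Rightarrow> bool" where
  "is_adjoint T S \<longleftrightarrow> (\<forall>x y. cinner (blinfun_apply T x) y = cinner x (blinfun_apply S y))"

definition adj :: "('h::complex_hilbert \<Rightarrow>\<^sub>L 'h) \<Rightarrow> ('h \<Rightarrow>\<^sub>L 'h)" where
  "adj T = (THE S. is_adjoint T S)"

text \<open>A von Neumann algebra: a strongly closed unital *-subalgebra of \<open>B(H)\<close>.\<close>

definition von_neumann_algebra :: "('h::complex_hilbert \<Rightarrow>\<^sub>L 'h) set \<Rightarrow> bool" where
  "von_neumann_algebra N \<longleftrightarrow>
     N \<subseteq> bounded_ops \<and> id_blinfun \<in> N \<and>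
     (\<forall>S\<in>N. \<forall>T\<in>N. S + T \<in> N) \<and>
     (\<forall>c. \<forall>T\<in>N. scaleC_op c T \<in> N) \<and>
     (\<forall>S\<in>N. \<forall>T\<in>N. S o\<^sub>L T \<in> N) \<and>
     (\<forall>T\<in>N. \<exists>S\<in>N. is_adjoint T S) \<and>
     closedin strong_operator_topology N"

definition positive_op :: "('h::complex_hilbert \<Rightarrow>\<^sub>L 'h) \<Rightarrow> bool" where
  "positive_op T \<longleftrightarrow> T \<in> bounded_ops \<and> (\<forall>x. cinner (blinfun_apply T x) x \<in> \<real>\<^sub>\<ge>\<^sub>0)"

definition op_le :: "('h::complex_hilbert \<Rightarrow>\<^sub>L 'h) \<Rightarrow> ('h \<Rightarrow>\<^sub>L 'h) \<Rightarrow> bool" where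
  "op_le S T \<longleftrightarrow> positive_op (T - S)"

definition tracial_state :: "('h::complex_hilbert \<Rightarrow>\<^sub>L 'h) set \<Rightarrow> (('h \<Rightarrow>\<^sub>L 'h) \<Rightarrow> complex) \<Rightarrow> bool" where
  "tracial_state N \<tau> \<longleftrightarrow>
     (\<forall>S\<in>N. \<forall>T\<in>N. \<tau> (S + T) = \<tau> S + \<tau> T) \<and>
     (\<forall>c. \<forall>T\<in>N. \<tau> (scaleC_op c T) = c * \<tau> T) \<and>
     (\<forall>T\<in>N. \<tau> (adj T o\<^sub>L T) \<in> \<real>\<^sub>\<ge>\<^sub>0) \<and>
     \<tau> id_blinfun = 1 \<and>
     (\<forall>S\<in>N. \<forall>T\<in>N. \<tau> (S o\<^sub>L T) = \<tau> (T o\<^sub>L S))"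

definition faithful_on :: "('h::complex_hilbert \<Rightarrow>\<^sub>L 'h) set \<Rightarrow> (('h \<Rightarrow>\<^sub>L 'h) \<Rightarrow> complex) \<Rightarrow> bool" where
  "faithful_on N \<tau> \<longleftrightarrow> (\<forall>T\<in>N. \<tau> (adj T o\<^sub>L T) = 0 \<longrightarrow> T = 0)"

text \<open>
  Normality: \<open>\<tau>\<close> preserves least upper bounds of upward directed families of
  positive elements of \<open>N\<close>.
\<close>

definition normal_on :: "('h::complex_hilbert \<Rightarrow>\<^sub>L 'h) set \<Rightarrow> (('h \<Rightarrow>\<^sub>L 'h) \<Rightarrow> complex) \<Rightarrow> bool" where
  "normal_on N \<tau> \<longleftrightarrow>
     (\<forall>D S. D \<noteq> {} \<and> D \<subseteq> {T \<in> N. positive_op T} \<and>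
        (\<forall>A\<in>D. \<forall>B\<in>D. \<exists>C\<in>D. op_le A C \<and> op_le B C) \<and>
        S \<in> N \<and> (\<forall>A\<in>D. op_le A S) \<and>
        (\<forall>R\<in>N. (\<forall>A\<in>D. op_le A R) \<longrightarrow> op_le S R)
      \<longrightarrow> Re (\<tau> S) = (SUP A\<in>D. Re (\<tau> A)))"

text \<open>
  The metric of the norm \<open>x \<mapsto> sqrt (\<tau> (adj x o\<^sub>L x))\<close> on \<open>N\<close>. It is set to 0 outside \<open>N\<close>, where
  \<open>\<tau>\<close> is arbitrary, because \<^locale>\<open>Metric_space\<close> requires nonnegativity and symmetry
  on the whole type.
\<close>

definition dist2 :: "('h::complex_hilbert \<Rightarrow>\<^sub>L 'h) set \<Rightarrow> (('h \<Rightarrow>\<^sub>L 'h) \<Rightarrow> complex)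
    \<Rightarrow> ('h \<Rightarrow>\<^sub>L 'h) \<Rightarrow> ('h \<Rightarrow>\<^sub>L 'h) \<Rightarrow> real" where
  "dist2 N \<tau> S T =
     (if S \<in> N \<and> T \<in> N then sqrt (Re (\<tau> (adj (S - T) o\<^sub>L (S - T)))) else 0)"

definition separable_finite_vN ::
  "('h::complex_hilbert \<Rightarrow>\<^sub>L 'h) set \<Rightarrow> (('h \<Rightarrow>\<^sub>L 'h) \<Rightarrow> complex) \<Rightarrow> bool" where
  "separable_finite_vN N \<tau> \<longleftrightarrow>
     von_neumann_algebra N \<and> tracial_state N \<tau> \<and> faithful_on N \<tau> \<and> normal_on N \<tau> \<and>
     separable_space (Metric_space.mtopology N (dist2 N \<tau>))"

definition unitary_group :: "('h::complex_hilbert \<Rightarrow>\<^sub>L 'h) set \<Rightarrow> ('h \<Rightarrow>\<^sub>L 'h) monoid" where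
  "unitary_group N =
     \<lparr>carrier = {U \<in> N. adj U o\<^sub>L U = id_blinfun \<and> U o\<^sub>L adj U = id_blinfun},
      mult = (o\<^sub>L), one = id_blinfun\<rparr>"

definition unitary_topology ::
  "('h::complex_hilbert \<Rightarrow>\<^sub>L 'h) set \<Rightarrow> (('h \<Rightarrow>\<^sub>L 'h) \<Rightarrow> complex) \<Rightarrow> ('h \<Rightarrow>\<^sub>L 'h) topology" where
  "unitary_topology N \<tau> =
     Metric_space.mtopology (carrier (unitary_group N)) (dist2 N \<tau>)"

text \<open>
  A formula cannot quantify over types, so the type \<open>'h\<close> of the Hilbert space on which
  the von Neumann algebra acts is a parameter.
\<close>

definition finite_type ::
  "'h::complex_hilbert itself \<Rightarrow> ('v, 'm) monoid_scheme \<Rightarrow> 'v topology \<Rightarrow> bool" where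
  "finite_type H V T \<longleftrightarrow>
     (\<exists>(N :: ('h \<Rightarrow>\<^sub>L 'h) set) \<tau>. separable_finite_vN N \<tau> \<and>
        closed_embedding V T (unitary_group N) (unitary_topology N \<tau>) \<noteq> {})"


section \<open>Measure preserving actions\<close>

definition standard_prob_space :: "'a measure \<Rightarrow> bool" where
  "standard_prob_space M \<longleftrightarrow>
     prob_space M \<and> (\<exists>T. polish_topology T \<and> topspace T = space M \<and> sets M = sets (borel_of_topology T))"

definition mp_action :: "('g, 'm) monoid_scheme \<Rightarrow> 'a measure \<Rightarrow> ('g \<Rightarrow> 'a \<Rightarrow> 'a) \<Rightarrow> bool" where
  "mp_action G M a \<longleftrightarrow>
     group_action G (space M) a \<and>
     (\<forall>g\<in>carrier G. a g \<in> M \<rightarrow>\<^sub>M M \<and> distr M M (a g) = M)"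

definition weakly_mixing :: "('g, 'm) monoid_scheme \<Rightarrow> 'a measure \<Rightarrow> ('g \<Rightarrow> 'a \<Rightarrow> 'a) \<Rightarrow> bool" where
  "weakly_mixing G M a \<longleftrightarrow>
     (\<forall>F \<epsilon>. finite F \<and> F \<subseteq> sets M \<and> 0 < \<epsilon> \<longrightarrow>
        (\<exists>g\<in>carrier G. \<forall>A\<in>F. \<forall>B\<in>F.
           \<bar>measure M (A \<inter> a g ` B) - measure M A * measure M B\<bar> < \<epsilon>))"

text \<open>
  The restriction to \<open>space (M \<Otimes>\<^sub>M N)\<close> is needed because \<^locale>\<open>group_action\<close> requires
  extensional maps.
\<close>

definition diag_action ::
  "'a measure \<Rightarrow> ('g \<Rightarrow> 'a \<Rightarrow> 'a) \<Rightarrow> 'b measure \<Rightarrow> ('g \<Rightarrow> 'b \<Rightarrow> 'b) \<Rightarrow> 'g \<Rightarrow> 'a \<times> 'b \<Rightarrow> 'a \<times> 'b" where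
  "diag_action M a N b g = (\<lambda>p \<in> space (M \<Otimes>\<^sub>M N). (a g (fst p), b g (snd p)))"


section \<open>Cocycles\<close>

definition cocycles ::
  "('g, 'm) monoid_scheme \<Rightarrow> 'a measure \<Rightarrow> ('g \<Rightarrow> 'a \<Rightarrow> 'a) \<Rightarrow>
   ('v, 'n) monoid_scheme \<Rightarrow> 'v topology \<Rightarrow> ('a \<times> 'g \<Rightarrow> 'v) set" where
  "cocycles G M a V T =
     {w \<in> M \<Otimes>\<^sub>M count_space (carrier G) \<rightarrow>\<^sub>M borel_of_topology T.
        \<forall>g\<in>carrier G. \<forall>h\<in>carrier G. AE t in M.
          w (t, g) \<otimes>\<^bsub>V\<^esub> w (a (inv\<^bsub>G\<^esub> g) t, h) = w (t, g \<otimes>\<^bsub>G\<^esub> h)}"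

definition cohomologous ::
  "('g, 'm) monoid_scheme \<Rightarrow> 'a measure \<Rightarrow> ('g \<Rightarrow> 'a \<Rightarrow> 'a) \<Rightarrow>
   ('v, 'n) monoid_scheme \<Rightarrow> 'v topology \<Rightarrow> ('a \<times> 'g \<Rightarrow> 'v) \<Rightarrow> ('a \<times> 'g \<Rightarrow> 'v) \<Rightarrow> bool" where
  "cohomologous G M a V T w w' \<longleftrightarrow>
     (\<exists>u \<in> M \<rightarrow>\<^sub>M borel_of_topology T. \<forall>g\<in>carrier G. AE t in M.
        w' (t, g) = inv\<^bsub>V\<^esub> (u t) \<otimes>\<^bsub>V\<^esub> w (t, g) \<otimes>\<^bsub>V\<^esub> u (a (inv\<^bsub>G\<^esub> g) t))"

end

theory Submission
  imports Defs
begin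

text \<open>
  For a von Neumann algebra with faithful trace, the trace norm defines a separable metric on
  the unitary group \<open>L\<close> that is invariant under left and right translations; this is all
  that is used about \<open>L\<close>. Let \<open>F (t, t', s) \<in> L\<close> intertwine \<open>w\<^sup>l\<close> and \<open>w\<^sup>r\<close>, and put
  \<open>K (t, t', y, s) = F (t, y, s) F (t', y, s)\<^sup>-\<^sup>1\<close>. The group acts on values of \<open>K\<close> by left and
  right multiplication with values of \<open>w\<close> that do not depend on \<open>y\<close>. So the distance of
  \<open>K (t, t', y, s)\<close> to \<open>K (t, t', y', s)\<close> and the distance of \<open>K (t, t', y, s)\<close> to \<open>\<V>\<close> are
  invariant functions, and by weak mixing the first does not depend on \<open>y, y'\<close>, the second
  not on \<open>t, t'\<close>. Independent values of a function into a separable metric space are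
  arbitrarily close with positive probability, so both distances vanish. Hence
  \<open>v (t, s) = K (t, t\<^sub>0, y\<^sub>0, s)\<close> is \<open>\<V>\<close>-valued for suitable \<open>t\<^sub>0, y\<^sub>0\<close>, and twisting \<open>w\<close> by
  \<open>v\<close> yields an expression in \<open>(t, s)\<close> that equals
  \<open>F (t\<^sub>0, y, s) w (y, s, g) F (t\<^sub>0, g\<^sup>-\<^sup>1 y, g\<^sup>-\<^sup>1 s)\<^sup>-\<^sup>1\<close>, so it depends on \<open>s\<close> alone.
\<close>

section \<open>Measure preserving maps and products\<close>

text \<open>Freezing the second variable of the intertwiner, as in \<open>F (t, t0, s)\<close>, does
  not give a transfer function, because the group moves \<open>t0\<close>. In \<open>K\<close> the
  variable \<open>y\<close> enters both factors in the same way and its contribution cancels; so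
  \<open>K\<close> may be evaluated at a fixed \<open>y0\<close> and, inside one computation, at
  \<open>y\<close> and at its translate. The remaining obstacle is that \<open>F\<close> has values
  in the larger group \<open>L\<close>, which is why the distance to the subgroup is treated as a
  second invariant function. The values of \<open>K\<close> are moved by left and right factors at
  once, so a metric invariant on one side only, which every Polish group has, would not do; the
  two-sided one comes from the trace. Weak mixing enters only through sets: a set in
  \<open>B \<times> X\<close> that is invariant under a product of measure preserving maps is, up to
  null sets, the preimage of a set in \<open>B\<close>. Here \<open>B\<close> collects
  \<open>s\<close> and the variables that are kept, and two such eliminations in a row remove a pair
  of variables. Untwisting to a group morphism is the case of a one-point \<open>Y\<close>.\<close>

definition mp_map :: "'a measure \<Rightarrow> 'b measure \<Rightarrow> ('a \<Rightarrow> 'b) \<Rightarrow> bool" where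
  "mp_map M N T \<longleftrightarrow> T \<in> M \<rightarrow>\<^sub>M N \<and> distr M N T = N"

lemma mp_map_measurable: "mp_map M N T \<Longrightarrow> T \<in> M \<rightarrow>\<^sub>M N"
  by (simp add: mp_map_def)

text \<open>The transport principle behind most steps below: an almost sure statement is pulled back
  along a coordinate map to more or rearranged coordinates, or along the action of a group
  element.\<close>

lemma mp_map_AE:
  assumes "mp_map M N T" "AE y in N. P y"
  shows "AE x in M. P (T x)"
  using assms unfolding mp_map_def by (metis AE_distrD)

lemma mp_map_measure:
  assumes "mp_map M N T" "A \<in> sets N"
  shows "measure M (T -` A \<inter> space M) = measure N A"
  using assms unfolding mp_map_def by (metis measure_distr)

lemma mp_map_integral:
  fixes f :: "'b \<Rightarrow> real"
  assumes "mp_map M N T" "f \<in> borel_measurable N"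
  shows "integral\<^sup>L M (\<lambda>x. f (T x)) = integral\<^sup>L N f"
  using assms unfolding mp_map_def by (metis integral_distr)

lemma mp_map_id: "mp_map M M (\<lambda>x. x)"
  by (simp add: mp_map_def)

lemma mp_map_comp:
  assumes "mp_map M N T" "mp_map N K S"
  shows "mp_map M K (\<lambda>x. S (T x))"
proof -
  have [measurable]: "T \<in> M \<rightarrow>\<^sub>M N" "S \<in> N \<rightarrow>\<^sub>M K"
    using assms by (auto simp: mp_map_def)
  have "distr M K (\<lambda>x. S (T x)) = distr (distr M N T) K S"
    by (simp add: distr_distr comp_def)
  then show ?thesis using assms by (simp add: mp_map_def)
qed

lemma mp_map_pair:
  assumes "mp_map M M' T" "mp_map N N' S" "prob_space M'" "prob_space N'"
  shows "mp_map (M \<Otimes>\<^sub>M N) (M' \<Otimes>\<^sub>M N') (\<lambda>p. (T (fst p), S (snd p)))"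
proof -
  interpret M': prob_space M' by fact
  interpret N': prob_space N' by fact
  have [measurable]: "T \<in> M \<rightarrow>\<^sub>M M'" "S \<in> N \<rightarrow>\<^sub>M N'" using assms by (auto simp: mp_map_def)
  have "distr M M' T \<Otimes>\<^sub>M distr N N' S = distr (M \<Otimes>\<^sub>M N) (M' \<Otimes>\<^sub>M N') (\<lambda>(x, y). (T x, S y))"
    using assms by (intro pair_measure_distr) (auto simp: mp_map_def N'.sigma_finite_measure_axioms)
  then show ?thesis
    using assms by (simp add: mp_map_def case_prod_beta')
qed

lemma mp_map_under:
  assumes "mp_map R R' T" "prob_space R'" "prob_space X"
  shows "mp_map (R \<Otimes>\<^sub>M X) (R' \<Otimes>\<^sub>M X) (\<lambda>p. (T (fst p), snd p))"
  using mp_map_pair[OF assms(1) mp_map_id assms(2,3)] .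

lemma mp_map_fst:
  assumes "prob_space X" "prob_space R"
  shows "mp_map (R \<Otimes>\<^sub>M X) R fst"
proof -
  interpret X: prob_space X by fact
  show ?thesis unfolding mp_map_def
  proof (intro conjI measurable_fst measure_eqI)
    fix A assume "A \<in> sets (distr (R \<Otimes>\<^sub>M X) R fst)"
    then have A: "A \<in> sets R" by simp
    have "fst -` A \<inter> space (R \<Otimes>\<^sub>M X) = A \<times> space X"
      using sets.sets_into_space[OF A] by (auto simp: space_pair_measure)
    then show "emeasure (distr (R \<Otimes>\<^sub>M X) R fst) A = emeasure R A"
      using A by (simp add: emeasure_distr X.emeasure_pair_measure_Times X.emeasure_space_1)
  qed simp
qed

lemma mp_map_swap:
  assumes "prob_space M" "prob_space N"
  shows "mp_map (M \<Otimes>\<^sub>M N) (N \<Otimes>\<^sub>M M) (\<lambda>p. (snd p, fst p))"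
proof -
  interpret M: prob_space M by fact
  interpret N: prob_space N by fact
  interpret pair_sigma_finite N M ..
  show ?thesis
    using distr_pair_swap by (simp add: mp_map_def case_prod_beta')
qed

lemma mp_map_snd:
  assumes "prob_space M" "prob_space N"
  shows "mp_map (M \<Otimes>\<^sub>M N) N snd"
  using mp_map_comp[OF mp_map_swap[OF assms] mp_map_fst[OF assms]] by simp

text \<open>Tonelli for indicator functions. Together with \<open>mp_map_swap\<close>,
  \<open>mp_map_fst\<close> and \<open>mp_map_under\<close> it generates the rearrangements of
  factors that occur later.\<close>

lemma mp_map_assoc:
  assumes "prob_space M" "prob_space N" "prob_space K"
  shows "mp_map ((M \<Otimes>\<^sub>M N) \<Otimes>\<^sub>M K) (M \<Otimes>\<^sub>M (N \<Otimes>\<^sub>M K)) (\<lambda>p. (fst (fst p), (snd (fst p), snd p)))"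
proof -
  interpret M: prob_space M by fact
  interpret N: prob_space N by fact
  interpret K: prob_space K by fact
  interpret NK: prob_space "N \<Otimes>\<^sub>M K" using assms(2,3) by (rule prob_space_pair)
  interpret MN: pair_sigma_finite M N ..
  let ?T = "\<lambda>p. (fst (fst p), (snd (fst p), snd p))"
  have T: "?T \<in> (M \<Otimes>\<^sub>M N) \<Otimes>\<^sub>M K \<rightarrow>\<^sub>M M \<Otimes>\<^sub>M (N \<Otimes>\<^sub>M K)" by measurable
  show ?thesis unfolding mp_map_def
  proof (intro conjI measure_eqI T)
    fix A assume "A \<in> sets (distr ((M \<Otimes>\<^sub>M N) \<Otimes>\<^sub>M K) (M \<Otimes>\<^sub>M (N \<Otimes>\<^sub>M K)) ?T)"
    then have A[measurable]: "A \<in> sets (M \<Otimes>\<^sub>M (N \<Otimes>\<^sub>M K))" by simp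
    have "emeasure (distr ((M \<Otimes>\<^sub>M N) \<Otimes>\<^sub>M K) (M \<Otimes>\<^sub>M (N \<Otimes>\<^sub>M K)) ?T) A
        = (\<integral>\<^sup>+p. indicator A (?T p) \<partial>((M \<Otimes>\<^sub>M N) \<Otimes>\<^sub>M K))"
      using T A by (subst nn_integral_indicator[symmetric], simp, subst nn_integral_distr) simp_all
    also have "\<dots> = (\<integral>\<^sup>+q. \<integral>\<^sup>+k. indicator A (fst q, (snd q, k)) \<partial>K \<partial>(M \<Otimes>\<^sub>M N))"
      by (subst K.nn_integral_fst[symmetric]) simp_all
    also have "\<dots> = (\<integral>\<^sup>+m. \<integral>\<^sup>+n. \<integral>\<^sup>+k. indicator A (m, (n, k)) \<partial>K \<partial>N \<partial>M)"
      by (subst N.nn_integral_fst[symmetric]) simp_all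
    also have "\<dots> = (\<integral>\<^sup>+m. \<integral>\<^sup>+q. indicator A (m, q) \<partial>(N \<Otimes>\<^sub>M K) \<partial>M)"
    proof (intro nn_integral_cong)
      fix m assume [measurable, simp]: "m \<in> space M"
      show "(\<integral>\<^sup>+n. \<integral>\<^sup>+k. indicator A (m, (n, k)) \<partial>K \<partial>N) = (\<integral>\<^sup>+q. indicator A (m, q) \<partial>(N \<Otimes>\<^sub>M K))"
        by (subst K.nn_integral_fst[symmetric]) simp_all
    qed
    also have "\<dots> = (\<integral>\<^sup>+p. indicator A p \<partial>(M \<Otimes>\<^sub>M (N \<Otimes>\<^sub>M K)))"
      by (subst NK.nn_integral_fst[symmetric]) simp_all
    also have "\<dots> = emeasure (M \<Otimes>\<^sub>M (N \<Otimes>\<^sub>M K)) A" by simp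
    finally show "emeasure (distr ((M \<Otimes>\<^sub>M N) \<Otimes>\<^sub>M K) (M \<Otimes>\<^sub>M (N \<Otimes>\<^sub>M K)) ?T) A = emeasure (M \<Otimes>\<^sub>M (N \<Otimes>\<^sub>M K)) A" .
  qed simp
qed

lemma mp_map_swap_last:
  assumes "prob_space R" "prob_space M" "prob_space N"
  shows "mp_map ((R \<Otimes>\<^sub>M M) \<Otimes>\<^sub>M N) ((R \<Otimes>\<^sub>M N) \<Otimes>\<^sub>M M) (\<lambda>p. ((fst (fst p), snd p), snd (fst p)))"
proof -
  have MN: "prob_space (M \<Otimes>\<^sub>M N)" "prob_space (R \<Otimes>\<^sub>M N)"
    using assms by (auto intro: prob_space_pair)
  have "mp_map ((R \<Otimes>\<^sub>M M) \<Otimes>\<^sub>M N) ((M \<Otimes>\<^sub>M N) \<Otimes>\<^sub>M R) (\<lambda>p. ((snd (fst p), snd p), fst (fst p)))"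
    using mp_map_comp[OF mp_map_assoc[OF assms] mp_map_swap[OF assms(1) MN(1)]] by simp
  from mp_map_comp[OF mp_map_comp[OF this mp_map_assoc[OF assms(2,3,1)]]
      mp_map_swap[OF assms(2) prob_space_pair[OF assms(3,1)]]]
  have *: "mp_map ((R \<Otimes>\<^sub>M M) \<Otimes>\<^sub>M N) ((N \<Otimes>\<^sub>M R) \<Otimes>\<^sub>M M) (\<lambda>p. ((snd p, fst (fst p)), snd (fst p)))"
    by simp
  show ?thesis
    using mp_map_comp[OF * mp_map_under[OF mp_map_swap[OF assms(3,1)] MN(2) assms(2)]] by simp
qed

text \<open>Runs against the direction of \<open>mp_map_AE\<close>: an auxiliary coordinate that
  \<open>P\<close> does not mention is discarded, because a constant truth value that holds almost
  everywhere on a space of mass one is true.\<close>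

lemma AE_fst:
  assumes "prob_space X" "AE p in R \<Otimes>\<^sub>M X. P (fst p)" and R: "prob_space R"
  shows "AE x in R. P x"
proof -
  interpret X: prob_space X by fact
  interpret R: prob_space R by fact
  interpret pair_sigma_finite R X ..
  have "AE x in R. AE y in X. P x" using AE_pair[OF assms(2)] by simp
  then show ?thesis by simp
qed

text \<open>Makes the last coordinate the outer one, ready to be frozen at a typical point by
  \<open>AE_ex\<close>; \<open>AE_pair\<close> alone would put the first factor outside.\<close>

lemma AE_pair_swap:
  assumes "prob_space M" "prob_space N" "AE p in M \<Otimes>\<^sub>M N. Q (fst p) (snd p)"
  shows "AE y in N. AE x in M. Q x y"
proof -
  interpret N: prob_space N by fact
  interpret M: prob_space M by fact
  interpret pair_sigma_finite N M ..
  have "AE p in N \<Otimes>\<^sub>M M. Q (snd p) (fst p)"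
    using mp_map_AE[OF mp_map_swap[OF assms(2,1)] assms(3)] by simp
  from AE_pair[OF this] show ?thesis by simp
qed

section \<open>Approximation by finite unions of rectangles\<close>

text \<open>
  Finite unions of rectangles \<open>C i \<times> {p = i}\<close> over a finite measurable partition of \<open>M\<close>; in this
  form they are disjoint, and closure under complements and unions is immediate.
\<close>

definition grid_sets :: "'b measure \<Rightarrow> 'a measure \<Rightarrow> ('b \<times> 'a) set set" where
  "grid_sets N M = {R. \<exists>p (n::nat) C. p \<in> M \<rightarrow>\<^sub>M count_space UNIV \<and> (\<forall>x. p x < n) \<and>
      (\<forall>i. C i \<in> sets N) \<and> R = {z \<in> space (N \<Otimes>\<^sub>M M). fst z \<in> C (p (snd z))}}"

lemma grid_sets_Times:
  assumes "B \<in> sets N" "A \<in> sets M"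
  shows "B \<times> A \<in> grid_sets N M"
proof -
  \<comment> \<open>Label \<open>1\<close> marks \<open>A\<close> and carries the side
    \<open>B\<close>; label \<open>0\<close> carries the empty set. Two labels give the bound
    \<open>2\<close>.\<close>
  have "(\<lambda>x. if x \<in> A then 1 else 0 :: nat) \<in> M \<rightarrow>\<^sub>M count_space UNIV"
    using assms by measurable
  then show ?thesis
    unfolding grid_sets_def using assms sets.sets_into_space[OF assms(1)] sets.sets_into_space[OF assms(2)]
    by (intro CollectI exI[of _ "\<lambda>x. if x \<in> A then 1 else 0"] exI[of _ 2] exI[of _ "\<lambda>i. if i = 1 then B else {}"])
       (auto simp: space_pair_measure split: if_splits)
qed

lemma grid_sets_compl:
  assumes "R \<in> grid_sets N M"
  shows "space (N \<Otimes>\<^sub>M M) - R \<in> grid_sets N M"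
proof -
  obtain p and n :: nat and C where *: "p \<in> M \<rightarrow>\<^sub>M count_space UNIV" "\<And>x. p x < n" "\<And>i. C i \<in> sets N"
    "R = {z \<in> space (N \<Otimes>\<^sub>M M). fst z \<in> C (p (snd z))}" using assms unfolding grid_sets_def by auto
  show ?thesis unfolding grid_sets_def using *(1-3)
    by (intro CollectI exI[of _ p] exI[of _ n] exI[of _ "\<lambda>i. space N - C i"])
       (auto simp: *(4) space_pair_measure)
qed

lemma grid_sets_Un:
  assumes "R \<in> grid_sets N M" "S \<in> grid_sets N M"
  shows "R \<union> S \<in> grid_sets N M"
proof -
  obtain p and n :: nat and C where *: "p \<in> M \<rightarrow>\<^sub>M count_space UNIV" "\<And>x. p x < n" "\<And>i. C i \<in> sets N"
    "R = {z \<in> space (N \<Otimes>\<^sub>M M). fst z \<in> C (p (snd z))}" using assms(1) unfolding grid_sets_def by auto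
  obtain q and m :: nat and D where **: "q \<in> M \<rightarrow>\<^sub>M count_space UNIV" "\<And>x. q x < m" "\<And>i. D i \<in> sets N"
    "S = {z \<in> space (N \<Otimes>\<^sub>M M). fst z \<in> D (q (snd z))}" using assms(2) unfolding grid_sets_def by auto
  \<comment> \<open>Common refinement of the two partitions: the pair of labels is coded as one
    number and decoded by \<open>mod n\<close> and \<open>div n\<close>, which works because
    \<open>p x < n\<close>.\<close>
  define r where "r = (\<lambda>x. p x + n * q x)"
  have r1: "r x mod n = p x" "r x div n = q x" for x
    using *(2)[of x] by (auto simp: r_def)
  have "r x < n * m" for x
  proof -
    have "r x < n * Suc (q x)" using *(2)[of x] by (simp add: r_def)
    also have "\<dots> \<le> n * m" using **(2)[of x] by (intro mult_le_mono2) simp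
    finally show ?thesis .
  qed
  moreover have "r \<in> M \<rightarrow>\<^sub>M count_space UNIV"
    unfolding r_def using *(1) **(1) by measurable
  ultimately show ?thesis unfolding grid_sets_def using *(3) **(3)
    by (intro CollectI exI[of _ r] exI[of _ "n * m"] exI[of _ "\<lambda>i. C (i mod n) \<union> D (i div n)"])
       (auto simp: *(4) **(4) space_pair_measure r1)
qed

lemma grid_sets_sets:
  assumes "R \<in> grid_sets N M"
  shows "R \<in> sets (N \<Otimes>\<^sub>M M)"
proof -
  obtain p and n :: nat and C where *: "p \<in> M \<rightarrow>\<^sub>M count_space UNIV" "\<And>x. p x < n" "\<And>i. C i \<in> sets N"
    "R = {z \<in> space (N \<Otimes>\<^sub>M M). fst z \<in> C (p (snd z))}" using assms unfolding grid_sets_def by auto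
  have [measurable]: "p \<in> M \<rightarrow>\<^sub>M count_space UNIV" "\<And>i. C i \<in> sets N" using * by auto
  have "R = (\<Union>i. C i \<times> (p -` {i} \<inter> space M))"
    using *(4) sets.sets_into_space[OF *(3)] by (auto simp: space_pair_measure)
  also have "\<dots> \<in> sets (N \<Otimes>\<^sub>M M)" by (intro sets.countable_UN) auto
  finally show ?thesis .
qed

text \<open>Dynkin induction on \<open>E\<close>. Complements leave the symmetric difference
  unchanged. For a countable union, continuity from below yields a finite partial union missing less
  than \<open>e / 2\<close>, and finite unions are approximated because grids are closed under
  union.\<close>

lemma grid_sets_approx:
  fixes e :: real
  assumes "prob_space N" "prob_space M" "E \<in> sets (N \<Otimes>\<^sub>M M)" "0 < e"
  shows "\<exists>R \<in> grid_sets N M. measure (N \<Otimes>\<^sub>M M) ((E - R) \<union> (R - E)) < e"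
proof -
  interpret P: prob_space "N \<Otimes>\<^sub>M M" using assms by (intro prob_space_pair)
  let ?P = "N \<Otimes>\<^sub>M M"
  let ?G = "{a \<times> b | a b. a \<in> sets N \<and> b \<in> sets M}"
  have "E \<in> sigma_sets (space N \<times> space M) ?G" using assms(3) by (simp add: sets_pair_measure)
  from Int_stable_pair_measure_generator pair_measure_closed this
  have "\<forall>e>0. \<exists>R \<in> grid_sets N M. measure ?P ((E - R) \<union> (R - E)) < e"
  proof (induction E rule: sigma_sets_induct_disjoint)
    case (basic A)
    then obtain a b where "A = a \<times> b" "a \<in> sets N" "b \<in> sets M" by auto
    then show ?case using grid_sets_Times[of a N b M] by (intro allI impI bexI[of _ A]) auto
  next
    case empty
    show ?case using grid_sets_Times[of "{}" N "{}" M] by (intro allI impI bexI[of _ "{}"]) auto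
  next
    case (compl A)
    show ?case
    proof (intro allI impI)
      fix e :: real assume "0 < e"
      with compl obtain R where R: "R \<in> grid_sets N M" "measure ?P ((A - R) \<union> (R - A)) < e" by blast
      have "A \<in> sets ?P" using compl by (simp add: sets_pair_measure)
      then have "A \<subseteq> space ?P" by (rule sets.sets_into_space)
      then have "(space N \<times> space M - A - (space ?P - R)) \<union> (space ?P - R - (space N \<times> space M - A))
          = (A - R) \<union> (R - A)"
        using sets.sets_into_space[OF grid_sets_sets[OF R(1)]] by (auto simp: space_pair_measure)
      then show "\<exists>R\<in>grid_sets N M. measure ?P ((space N \<times> space M - A - R) \<union> (R - (space N \<times> space M - A))) < e"
        using R grid_sets_compl[OF R(1)] by (intro bexI[of _ "space ?P - R"]) auto
    qed
  next
    case (union A)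
    have A[measurable]: "\<And>i. A i \<in> sets ?P" using union by (auto simp: sets_pair_measure)
    have fin: "\<forall>e>0. \<exists>R \<in> grid_sets N M. measure ?P (((\<Union>i<k. A i) - R) \<union> (R - (\<Union>i<k. A i))) < e" for k
    proof (induction k)
      case 0
      then show ?case using grid_sets_Times[of "{}" N "{}" M] by (intro allI impI bexI[of _ "{}"]) auto
    next
      case (Suc k)
      show ?case
      proof (intro allI impI)
        fix e :: real assume e: "0 < e"
        then obtain R where R: "R \<in> grid_sets N M"
            "measure ?P (((\<Union>i<k. A i) - R) \<union> (R - (\<Union>i<k. A i))) < e / 2"
          using Suc half_gt_zero by blast
        obtain S where S: "S \<in> grid_sets N M" "measure ?P ((A k - S) \<union> (S - A k)) < e / 2"
          using e union(3) half_gt_zero by blast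
        have [measurable]: "R \<in> sets ?P" "S \<in> sets ?P" using R(1) S(1) by (auto intro: grid_sets_sets)
        have "measure ?P (((\<Union>i<Suc k. A i) - (R \<union> S)) \<union> ((R \<union> S) - (\<Union>i<Suc k. A i)))
           \<le> measure ?P ((((\<Union>i<k. A i) - R) \<union> (R - (\<Union>i<k. A i))) \<union> ((A k - S) \<union> (S - A k)))"
          by (intro P.finite_measure_mono) (auto simp: lessThan_Suc)
        also have "\<dots> \<le> measure ?P (((\<Union>i<k. A i) - R) \<union> (R - (\<Union>i<k. A i))) + measure ?P ((A k - S) \<union> (S - A k))"
          by (intro measure_Un_le) auto
        also have "\<dots> < e" using R S by simp
        finally show "\<exists>R\<in>grid_sets N M. measure ?P (((\<Union>i<Suc k. A i) - R) \<union> (R - (\<Union>i<Suc k. A i))) < e"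
          using grid_sets_Un[OF R(1) S(1)] by blast
      qed
    qed
    show ?case
    proof (intro allI impI)
      fix e :: real assume e: "0 < e"
      have "(\<lambda>k. measure ?P (\<Union>i<k. A i)) \<longlonglongrightarrow> measure ?P (\<Union>k. \<Union>i<k. A i)"
        by (intro P.finite_Lim_measure_incseq) (auto simp: incseq_def intro: less_le_trans)
      also have "(\<Union>k. \<Union>i<k. A i) = (\<Union>i. A i)" by auto
      finally have "\<forall>\<^sub>F k in sequentially. measure ?P (\<Union>i. A i) - e / 2 < measure ?P (\<Union>i<k. A i)"
        using e by (intro order_tendstoD(1)) auto
      then obtain k where k: "measure ?P (\<Union>i. A i) - e / 2 < measure ?P (\<Union>i<k. A i)"
        using eventually_happens trivial_limit_sequentially by blast
      obtain R where R: "R \<in> grid_sets N M"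
            "measure ?P (((\<Union>i<k. A i) - R) \<union> (R - (\<Union>i<k. A i))) < e / 2"
          using fin e half_gt_zero by blast
      have [measurable]: "R \<in> sets ?P" using R(1) by (auto intro: grid_sets_sets)
      have "measure ?P (((\<Union>i. A i) - R) \<union> (R - (\<Union>i. A i)))
         \<le> measure ?P ((((\<Union>i<k. A i) - R) \<union> (R - (\<Union>i<k. A i))) \<union> ((\<Union>i. A i) - (\<Union>i<k. A i)))"
          by (intro P.finite_measure_mono) auto
      also have "\<dots> \<le> measure ?P (((\<Union>i<k. A i) - R) \<union> (R - (\<Union>i<k. A i))) + measure ?P ((\<Union>i. A i) - (\<Union>i<k. A i))"
          by (intro measure_Un_le) auto
      also have "measure ?P ((\<Union>i. A i) - (\<Union>i<k. A i)) = measure ?P (\<Union>i. A i) - measure ?P (\<Union>i<k. A i)"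
        by (intro P.finite_measure_Diff) auto
      finally show "\<exists>R\<in>grid_sets N M. measure ?P ((\<Union>(range A) - R) \<union> (R - \<Union>(range A))) < e"
          using R k by (intro bexI[OF _ R(1)]) auto
    qed
  qed
  then show ?thesis using assms(4) by blast
qed

section \<open>Weak mixing and invariant sets\<close>

lemma mp_action_mp_map:
  assumes "mp_action G M a" "g \<in> carrier G"
  shows "mp_map M M (a g)"
  using assms by (auto simp: mp_action_def mp_map_def)

text \<open>Weak mixing is stated with images, measure preservation with preimages. This conversion
  is why the inverse of the mixing element appears in the following lemmas.\<close>

lemma mp_action_image_eq_vimage:
  assumes "mp_action G M a" "g \<in> carrier G" "B \<subseteq> space M"
  shows "a g ` B = a (inv\<^bsub>G\<^esub> g) -` B \<inter> space M"
proof -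
  interpret group_action G "space M" a using assms(1) by (simp add: mp_action_def)
  interpret group G using group_hom by (rule group_hom.axioms)
  have inv: "inv\<^bsub>G\<^esub> g \<in> carrier G" using assms(2) by simp
  show ?thesis
  proof (intro Set.set_eqI iffI)
    fix y assume "y \<in> a g ` B"
    then obtain x where "x \<in> B" "y = a g x" by auto
    then show "y \<in> a (inv\<^bsub>G\<^esub> g) -` B \<inter> space M"
      using assms element_image[OF assms(2)] orbit_sym_aux[OF assms(2), of x y] by auto
  next
    fix y assume y: "y \<in> a (inv\<^bsub>G\<^esub> g) -` B \<inter> space M"
    then have "a g (a (inv\<^bsub>G\<^esub> g) y) = y"
      using orbit_sym_aux[OF inv, of y "a (inv\<^bsub>G\<^esub> g) y"] assms(2) by simp
    then show "y \<in> a g ` B" using y by (metis IntD1 image_eqI vimageD)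
  qed
qed

text \<open>\<open>R\<close> meets its translate in the disjoint rectangles
  \<open>(C i \<inter> Cj j) \<times> (A i \<inter> Aj j)\<close>. Mixing, applied once to the
  finitely many \<open>A i\<close>, splits the measure of every second side into a product. What
  remains on \<open>B\<close> is the correlation of the section measure \<open>r\<close> with its
  translate, which is at most the integral of the square of \<open>r\<close>.\<close>

lemma weakly_mixing_grid_sets:
  fixes B :: "'b measure" and X :: "'a measure"
  assumes "prob_space B" "prob_space X" "mp_action G X \<sigma>" "weakly_mixing G X \<sigma>" "group G"
    and \<beta>: "\<And>g. g \<in> carrier G \<Longrightarrow> mp_map B B (\<beta> g)"
    and "R \<in> grid_sets B X" "0 < (\<delta>::real)"
  shows "\<exists>g\<in>carrier G. measure (B \<Otimes>\<^sub>M X)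
      {z \<in> R. (\<beta> (inv\<^bsub>G\<^esub> g) (fst z), \<sigma> (inv\<^bsub>G\<^esub> g) (snd z)) \<in> R}
      \<le> (\<integral>b. (measure X (Pair b -` R))\<^sup>2 \<partial>B) + \<delta>"
proof -
  interpret B: prob_space B by fact
  interpret X: prob_space X by fact
  interpret G: group G by fact
  interpret P: prob_space "B \<Otimes>\<^sub>M X" using assms(1,2) by (rule prob_space_pair)
  obtain p and n :: nat and C where p[measurable]: "p \<in> X \<rightarrow>\<^sub>M count_space UNIV" and pn: "\<And>x. p x < n"
    and C[measurable]: "\<And>i. C i \<in> sets B"
    and R: "R = {z \<in> space (B \<Otimes>\<^sub>M X). fst z \<in> C (p (snd z))}"
    using assms(7) unfolding grid_sets_def by auto
  define A where "A i = p -` {i} \<inter> space X" for i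
  have A[measurable]: "A i \<in> sets X" for i unfolding A_def by measurable
  have Asub: "A i \<subseteq> space X" for i by (auto simp: A_def)
  \<comment> \<open>There are \<open>n * n\<close> pairs of labels, each costing at most
    \<open>\<epsilon>\<close>; the \<open>+ 1\<close> keeps the denominator positive without a case
    distinction on \<open>n\<close>.\<close>
  define \<epsilon> where "\<epsilon> = \<delta> / (real n * real n + 1)"
  have \<epsilon>: "0 < \<epsilon>" using assms(8) by (simp add: \<epsilon>_def add_nonneg_pos)
  have n\<epsilon>: "real n * real n * \<epsilon> \<le> \<delta>"
  proof -
    have "\<epsilon> * (real n * real n + 1) = \<delta>"
      using add_nonneg_pos[of "real n * real n" 1] by (simp add: \<epsilon>_def)
    then show ?thesis using \<epsilon> by (simp add: algebra_simps)
  qed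
  have "finite (A ` {..<n})" "A ` {..<n} \<subseteq> sets X" by auto
  then obtain g where g: "g \<in> carrier G" and
    wm: "\<And>i j. i < n \<Longrightarrow> j < n \<Longrightarrow>
      \<bar>measure X (A i \<inter> \<sigma> g ` A j) - measure X (A i) * measure X (A j)\<bar> < \<epsilon>"
    using assms(4) \<epsilon> unfolding weakly_mixing_def by (metis image_eqI lessThan_iff)
  define h where "h = inv\<^bsub>G\<^esub> g"
  have h: "h \<in> carrier G" using g by (simp add: h_def)
  have \<beta>h: "mp_map B B (\<beta> h)" and \<sigma>h: "mp_map X X (\<sigma> h)"
    using \<beta>[OF h] mp_action_mp_map[OF assms(3) h] by auto
  have [measurable]: "\<beta> h \<in> B \<rightarrow>\<^sub>M B" "\<sigma> h \<in> X \<rightarrow>\<^sub>M X" using \<beta>h \<sigma>h by (auto simp: mp_map_def)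
  define Cj where "Cj j = \<beta> h -` C j \<inter> space B" for j
  define Aj where "Aj j = \<sigma> h -` A j \<inter> space X" for j
  have [measurable]: "Cj j \<in> sets B" "Aj j \<in> sets X" for j unfolding Cj_def Aj_def by measurable
  have wm': "measure X (A i \<inter> Aj j) \<le> measure X (A i) * measure X (A j) + \<epsilon>" if "i < n" "j < n" for i j
    using wm[OF that] mp_action_image_eq_vimage[OF assms(3) g Asub, of j] by (simp add: Aj_def h_def)
  define S where "S = {z \<in> R. (\<beta> h (fst z), \<sigma> h (snd z)) \<in> R}"
  let ?I = "{..<n} \<times> {..<n}"
  define D where "D = (\<lambda>(i, j). (C i \<inter> Cj j) \<times> (A i \<inter> Aj j))"
  have hsp: "\<beta> h b \<in> space B" if "b \<in> space B" for b using that by (meson \<open>\<beta> h \<in> B \<rightarrow>\<^sub>M B\<close> measurable_space)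
  have hsp': "\<sigma> h b \<in> space X" if "b \<in> space X" for b using that by (meson \<open>\<sigma> h \<in> X \<rightarrow>\<^sub>M X\<close> measurable_space)
  have Csub: "C i \<subseteq> space B" for i using C by (rule sets.sets_into_space)
  have "S = (\<Union>k\<in>?I. D k)"
    using pn Csub hsp hsp' by (fastforce simp: S_def R D_def A_def Aj_def Cj_def space_pair_measure)
  moreover have "disjoint_family_on D ?I"
    by (auto simp: disjoint_family_on_def D_def A_def Aj_def)
  moreover have "D k \<in> sets (B \<Otimes>\<^sub>M X)" for k by (auto simp: D_def split: prod.split)
  ultimately have "measure (B \<Otimes>\<^sub>M X) S = (\<Sum>k\<in>?I. measure (B \<Otimes>\<^sub>M X) (D k))"
    by (simp add: P.finite_measure_finite_Union image_subset_iff)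
  also have "\<dots> = (\<Sum>(i,j)\<in>?I. measure B (C i \<inter> Cj j) * measure X (A i \<inter> Aj j))"
    by (intro sum.cong refl) (auto simp: D_def measure_def X.emeasure_pair_measure_Times enn2real_mult)
  also have "\<dots> \<le> (\<Sum>(i,j)\<in>?I. measure B (C i \<inter> Cj j) * (measure X (A i) * measure X (A j)) + \<epsilon>)"
  proof (intro sum_mono, clarify)
    fix i j assume "i < n" "j < n"
    then have "measure B (C i \<inter> Cj j) * measure X (A i \<inter> Aj j)
      \<le> measure B (C i \<inter> Cj j) * (measure X (A i) * measure X (A j) + \<epsilon>)"
      by (intro mult_left_mono wm') auto
    also have "\<dots> \<le> measure B (C i \<inter> Cj j) * (measure X (A i) * measure X (A j)) + 1 * \<epsilon>"
      unfolding distrib_left using \<epsilon> by (intro add_left_mono mult_right_mono) auto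
    finally show "measure B (C i \<inter> Cj j) * measure X (A i \<inter> Aj j)
      \<le> measure B (C i \<inter> Cj j) * (measure X (A i) * measure X (A j)) + \<epsilon>" by simp
  qed
  also have "\<dots> \<le> (\<Sum>(i,j)\<in>?I. measure B (C i \<inter> Cj j) * (measure X (A i) * measure X (A j))) + \<delta>"
    using n\<epsilon> by (simp add: case_prod_beta sum.distrib)
  finally have le: "measure (B \<Otimes>\<^sub>M X) S
      \<le> (\<Sum>(i,j)\<in>?I. measure B (C i \<inter> Cj j) * (measure X (A i) * measure X (A j))) + \<delta>" .
  define r where "r b = (\<Sum>i<n. indicator (C i) b * measure X (A i))" for b
  have r[measurable]: "r \<in> borel_measurable B" unfolding r_def by measurable
  have r_eq: "measure X (Pair b -` R) = r b" if b: "b \<in> space B" for b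
  proof -
    have "Pair b -` R = (\<Union>i\<in>{i\<in>{..<n}. b \<in> C i}. A i)"
      using pn b by (auto simp: R A_def space_pair_measure)
    moreover have "disjoint_family_on A {i\<in>{..<n}. b \<in> C i}"
      by (auto simp: disjoint_family_on_def A_def)
    ultimately have "measure X (Pair b -` R) = (\<Sum>i\<in>{i\<in>{..<n}. b \<in> C i}. measure X (A i))"
      by (simp add: X.finite_measure_finite_Union image_subset_iff)
    also have "\<dots> = r b" unfolding r_def
      by (intro sum.mono_neutral_cong_left) (auto simp: indicator_def)
    finally show ?thesis .
  qed
  have rbd: "0 \<le> r b" "r b \<le> 1" if "b \<in> space B" for b using r_eq[OF that] by (metis X.prob_le_1 measure_nonneg)+
  have int_sq: "integrable B (\<lambda>b. (r b)\<^sup>2)"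
    by (intro B.integrable_const_bound[where B=1]) (auto intro!: power_le_one simp: rbd)
  have int_sq': "integrable B (\<lambda>b. (r (\<beta> h b))\<^sup>2)"
    by (intro B.integrable_const_bound[where B=1]) (auto intro!: power_le_one simp: rbd hsp)
  have int_rr: "integrable B (\<lambda>b. r b * r (\<beta> h b))"
    by (intro B.integrable_const_bound[where B=1]) (auto intro!: mult_le_one simp: rbd hsp abs_mult)
  have "(\<Sum>(i,j)\<in>?I. measure B (C i \<inter> Cj j) * (measure X (A i) * measure X (A j)))
    = (\<Sum>(i,j)\<in>?I. (\<integral>b. indicator (C i \<inter> Cj j) b * (measure X (A i) * measure X (A j)) \<partial>B))"
    by simp
  also have "\<dots> = (\<integral>b. (\<Sum>(i,j)\<in>?I. indicator (C i \<inter> Cj j) b * (measure X (A i) * measure X (A j))) \<partial>B)"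
    unfolding case_prod_beta
    by (subst Bochner_Integration.integral_sum) (auto intro!: integrable_mult_left integrable_real_indicator simp: less_top[symmetric])
  also have "\<dots> = (\<integral>b. r b * r (\<beta> h b) \<partial>B)"
  proof (intro Bochner_Integration.integral_cong refl)
    fix b assume b: "b \<in> space B"
    show "(\<Sum>(i,j)\<in>?I. indicator (C i \<inter> Cj j) b * (measure X (A i) * measure X (A j))) = r b * r (\<beta> h b)"
      unfolding r_def sum_product sum.cartesian_product
      by (intro sum.cong refl) (auto simp: Cj_def b indicator_def)
  qed
  \<comment> \<open>Nothing mixes on \<open>B\<close>, so the correlation is only bounded: the
    product is at most the mean of the squares, and both squares have the same integral because
    \<open>\<beta> h\<close> preserves the measure.\<close>
  also have "\<dots> \<le> (\<integral>b. ((r b)\<^sup>2 + (r (\<beta> h b))\<^sup>2) / 2 \<partial>B)"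
  proof (intro integral_mono int_rr)
    show "integrable B (\<lambda>b. ((r b)\<^sup>2 + (r (\<beta> h b))\<^sup>2) / 2)" using int_sq int_sq' by auto
    show "r b * r (\<beta> h b) \<le> ((r b)\<^sup>2 + (r (\<beta> h b))\<^sup>2) / 2" for b
      using sum_squares_bound[of "r b" "r (\<beta> h b)"] by simp
  qed
  also have "\<dots> = ((\<integral>b. (r b)\<^sup>2 \<partial>B) + (\<integral>b. (r (\<beta> h b))\<^sup>2 \<partial>B)) / 2"
    using int_sq int_sq' by simp
  also have "(\<integral>b. (r (\<beta> h b))\<^sup>2 \<partial>B) = (\<integral>b. (r b)\<^sup>2 \<partial>B)"
    by (rule mp_map_integral[OF \<beta>h]) measurable
  also have "((\<integral>b. (r b)\<^sup>2 \<partial>B) + (\<integral>b. (r b)\<^sup>2 \<partial>B)) / 2 = (\<integral>b. (measure X (Pair b -` R))\<^sup>2 \<partial>B)"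
    by (simp add: r_eq cong: Bochner_Integration.integral_cong)
  finally show ?thesis using le g unfolding S_def h_def by (intro bexI[of _ g]) auto
qed

text \<open>
  Compare \<open>E\<close> with a finite union \<open>R\<close> of rectangles: mixing makes \<open>X\<close>-sections of \<open>R\<close> and
  of its translate almost independent, so the sections of \<open>E\<close> satisfy \<open>\<integral> e \<le> \<integral> e\<^sup>2\<close>, where
  \<open>e b\<close> is the measure of the section at \<open>b\<close>.
\<close>

lemma weakly_mixing_invariant_set:
  fixes B :: "'b measure" and X :: "'a measure"
  assumes "prob_space B" "prob_space X" "mp_action G X \<sigma>" "weakly_mixing G X \<sigma>" "group G"
    and \<beta>: "\<And>g. g \<in> carrier G \<Longrightarrow> mp_map B B (\<beta> g)"
    and E[measurable]: "E \<in> sets (B \<Otimes>\<^sub>M X)"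
    and inv: "\<And>g. g \<in> carrier G \<Longrightarrow>
      AE z in B \<Otimes>\<^sub>M X. (\<beta> g (fst z), \<sigma> g (snd z)) \<in> E \<longleftrightarrow> z \<in> E"
  shows "\<exists>E' \<in> sets B. (AE z in B \<Otimes>\<^sub>M X. z \<in> E \<longleftrightarrow> fst z \<in> E') \<and>
     (\<forall>g\<in>carrier G. AE b in B. \<beta> g b \<in> E' \<longleftrightarrow> b \<in> E')"
proof -
  interpret B: prob_space B by fact
  interpret X: prob_space X by fact
  interpret G: group G by fact
  interpret P: prob_space "B \<Otimes>\<^sub>M X" using assms(1,2) by (rule prob_space_pair)
  interpret pair_sigma_finite B X ..
  define e where "e b = measure X (Pair b -` E)" for b
  have sec: "Pair b -` S \<in> sets X" if "S \<in> sets (B \<Otimes>\<^sub>M X)" for b S using that by (rule sets_Pair1)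
  have meas: "(\<lambda>b. measure X (Pair b -` S)) \<in> borel_measurable B"
    if "S \<in> sets (B \<Otimes>\<^sub>M X)" for S
    using X.measurable_emeasure_Pair[OF that] unfolding measure_def by measurable
  have int: "integrable B (\<lambda>b. measure X (Pair b -` S))" if "S \<in> sets (B \<Otimes>\<^sub>M X)" for S
    using meas[OF that] by (intro B.integrable_const_bound[where B=1]) auto
  have total: "(\<integral>b. measure X (Pair b -` S) \<partial>B) = measure (B \<Otimes>\<^sub>M X) S" if "S \<in> sets (B \<Otimes>\<^sub>M X)" for S
  proof -
    have "ennreal (measure (B \<Otimes>\<^sub>M X) S) = (\<integral>\<^sup>+b. emeasure X (Pair b -` S) \<partial>B)"
      by (simp add: X.emeasure_pair_measure_alt[OF that] P.emeasure_eq_measure[symmetric])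
    also have "\<dots> = (\<integral>\<^sup>+b. ennreal (measure X (Pair b -` S)) \<partial>B)"
      by (simp add: X.emeasure_eq_measure)
    also have "\<dots> = ennreal (\<integral>b. measure X (Pair b -` S) \<partial>B)"
      by (rule nn_integral_eq_integral[OF int[OF that]]) simp
    finally show ?thesis by (simp add: integral_nonneg_AE)
  qed
  have e[measurable]: "e \<in> borel_measurable B" unfolding e_def by (rule meas[OF E])
  have e01: "0 \<le> e b" "e b \<le> 1" for b by (auto simp: e_def)
  have int_e: "integrable B e" unfolding e_def by (rule int[OF E])
  have int_sq: "integrable B (\<lambda>b. (measure X (Pair b -` S))\<^sup>2)" if "S \<in> sets (B \<Otimes>\<^sub>M X)" for S
    using meas[OF that] by (intro B.integrable_const_bound[where B=1] borel_measurable_power) (auto simp: power_le_one)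
  have int_esq: "integrable B (\<lambda>b. (e b)\<^sup>2)" unfolding e_def by (rule int_sq[OF E])
  have tot_e: "(\<integral>b. e b \<partial>B) = measure (B \<Otimes>\<^sub>M X) E" unfolding e_def by (rule total[OF E])
  \<comment> \<open>The five errors: one from mixing, two from replacing \<open>E\<close> and its
    translate by \<open>R\<close>, and two from comparing the squares of the section measures, where
    the factor \<open>?r + e b\<close> is at most \<open>2\<close>.\<close>
  have key: "(\<integral>b. e b - (e b)\<^sup>2 \<partial>B) \<le> 5 * \<delta>" if \<delta>: "0 < \<delta>" for \<delta>
  proof -
    obtain R where R: "R \<in> grid_sets B X" and RE: "measure (B \<Otimes>\<^sub>M X) ((E - R) \<union> (R - E)) < \<delta>"
      using grid_sets_approx[OF assms(1,2) E \<delta>] by blast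
    note [measurable] = grid_sets_sets[OF R]
    have "\<exists>g\<in>carrier G. measure (B \<Otimes>\<^sub>M X) {z \<in> R. (\<beta> (inv\<^bsub>G\<^esub> g) (fst z), \<sigma> (inv\<^bsub>G\<^esub> g) (snd z)) \<in> R}
      \<le> (\<integral>b. (measure X (Pair b -` R))\<^sup>2 \<partial>B) + \<delta>"
      by (rule weakly_mixing_grid_sets[OF assms(1-5) \<beta> R \<delta>])
    then obtain g where g: "g \<in> carrier G" and
      mix: "measure (B \<Otimes>\<^sub>M X) {z \<in> R. (\<beta> (inv\<^bsub>G\<^esub> g) (fst z), \<sigma> (inv\<^bsub>G\<^esub> g) (snd z)) \<in> R}
      \<le> (\<integral>b. (measure X (Pair b -` R))\<^sup>2 \<partial>B) + \<delta>"
      by (elim bexE)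
    define h where "h = inv\<^bsub>G\<^esub> g"
    have h: "h \<in> carrier G" using g by (simp add: h_def)
    define T where "T = (\<lambda>z. (\<beta> h (fst z), \<sigma> h (snd z)))"
    have T: "mp_map (B \<Otimes>\<^sub>M X) (B \<Otimes>\<^sub>M X) T" unfolding T_def
      by (intro mp_map_pair \<beta> mp_action_mp_map[OF assms(3)] h assms(1,2))
    have [measurable]: "T \<in> B \<Otimes>\<^sub>M X \<rightarrow>\<^sub>M B \<Otimes>\<^sub>M X" using T by (rule mp_map_measurable)
    let ?D = "(E - R) \<union> (R - E)"
    let ?S = "{z \<in> R. T z \<in> R}"
    have Rsp: "z \<in> space (B \<Otimes>\<^sub>M X)" if "z \<in> R" for z
      using that sets.sets_into_space[OF grid_sets_sets[OF R]] by auto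
    have "?S = R \<inter> (T -` R \<inter> space (B \<Otimes>\<^sub>M X))" using Rsp by auto
    then have [measurable]: "?S \<in> sets (B \<Otimes>\<^sub>M X)" by simp
    \<comment> \<open>By invariance a point \<open>z\<close> of \<open>E\<close> has
      \<open>T z\<close> in \<open>E\<close> as well. So either both lie in \<open>R\<close>, or one
      of them lies in the symmetric difference \<open>?D\<close>.\<close>
    have "measure (B \<Otimes>\<^sub>M X) E \<le> measure (B \<Otimes>\<^sub>M X) (?S \<union> (?D \<union> (T -` ?D \<inter> space (B \<Otimes>\<^sub>M X))))"
    proof (rule P.finite_measure_mono_AE)
      show "AE x in B \<Otimes>\<^sub>M X. x \<in> E \<longrightarrow> x \<in> ?S \<union> (?D \<union> (T -` ?D \<inter> space (B \<Otimes>\<^sub>M X)))"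
        using inv[OF h] AE_space by eventually_elim (auto simp: T_def)
    qed measurable
    also have "\<dots> \<le> measure (B \<Otimes>\<^sub>M X) ?S + (measure (B \<Otimes>\<^sub>M X) ?D + measure (B \<Otimes>\<^sub>M X) (T -` ?D \<inter> space (B \<Otimes>\<^sub>M X)))"
      by (intro order_trans[OF measure_Un_le] add_left_mono measure_Un_le) auto
    also have "measure (B \<Otimes>\<^sub>M X) (T -` ?D \<inter> space (B \<Otimes>\<^sub>M X)) = measure (B \<Otimes>\<^sub>M X) ?D"
      by (rule mp_map_measure[OF T]) measurable
    finally have 1: "measure (B \<Otimes>\<^sub>M X) E \<le> (\<integral>b. (measure X (Pair b -` R))\<^sup>2 \<partial>B) + 3 * \<delta>"
      using mix RE by (simp add: T_def h_def)
    have "(\<integral>b. (measure X (Pair b -` R))\<^sup>2 \<partial>B) \<le> (\<integral>b. (e b)\<^sup>2 + 2 * measure X (Pair b -` ?D) \<partial>B)"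
    proof (intro integral_mono)
      show "integrable B (\<lambda>b. (e b)\<^sup>2 + 2 * measure X (Pair b -` ?D))"
        using int_sq[OF E] int[of ?D] by (auto simp: e_def)
      show "integrable B (\<lambda>b. (measure X (Pair b -` R))\<^sup>2)" by (rule int_sq) measurable
      fix b
      let ?r = "measure X (Pair b -` R)" and ?d = "measure X (Pair b -` ?D)"
      have "?r \<le> measure X (Pair b -` E \<union> Pair b -` ?D)"
        by (intro X.finite_measure_mono sets.Un sec) auto
      also have "\<dots> \<le> e b + ?d" unfolding e_def by (intro measure_Un_le sec) auto
      finally have d: "?r - e b \<le> ?d" by simp
      have "?r\<^sup>2 - (e b)\<^sup>2 = (?r - e b) * (?r + e b)" by (simp add: power2_eq_square algebra_simps)
      also have "\<dots> \<le> ?d * (?r + e b)" using d e01[of b] by (intro mult_right_mono) auto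
      also have "\<dots> \<le> ?d * 2" using add_mono[OF X.prob_le_1 e01(2), of "Pair b -` R" b] by (intro mult_left_mono) auto
      finally show "?r\<^sup>2 \<le> (e b)\<^sup>2 + 2 * ?d" by simp
    qed
    also have "\<dots> = (\<integral>b. (e b)\<^sup>2 \<partial>B) + 2 * measure (B \<Otimes>\<^sub>M X) ?D"
      using int_sq[OF E] int[of ?D] total[of ?D] by (simp add: e_def)
    finally have "measure (B \<Otimes>\<^sub>M X) E \<le> (\<integral>b. (e b)\<^sup>2 \<partial>B) + 5 * \<delta>" using 1 RE by simp
    then show ?thesis
      using int_e int_esq tot_e by simp
  qed
  \<comment> \<open>Since \<open>e\<close> lies between 0 and 1, the integrand is nonnegative. A
    nonpositive integral therefore forces almost every section to be null or conull, and
    \<open>E'\<close> below collects the conull ones.\<close>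
  have "(\<integral>b. e b - (e b)\<^sup>2 \<partial>B) \<le> 0"
  proof (rule field_le_epsilon)
    fix \<delta> :: real assume "0 < \<delta>"
    then show "(\<integral>b. e b - (e b)\<^sup>2 \<partial>B) \<le> 0 + \<delta>" using key[of "\<delta> / 5"] by simp
  qed
  moreover have nn: "0 \<le> e b - (e b)\<^sup>2" for b using e01[of b] mult_left_le[of "e b" "e b"] by (simp add: power2_eq_square)
  ultimately have "(\<integral>b. e b - (e b)\<^sup>2 \<partial>B) = 0" by (simp add: integral_nonneg_AE order_antisym)
  then have "AE b in B. e b - (e b)\<^sup>2 = 0"
    using integral_nonneg_eq_0_iff_AE[of B "\<lambda>b. e b - (e b)\<^sup>2"] int_e int_esq nn by simp
  then have zero_one: "AE b in B. e b = 0 \<or> e b = 1"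
    by eventually_elim (simp add: power2_eq_square)
  define E' where "E' = {b \<in> space B. e b = 1}"
  have E'[measurable]: "E' \<in> sets B" unfolding E'_def by measurable
  have "AE b in B. AE x in X. (b, x) \<in> E \<longleftrightarrow> b \<in> E'"
    using zero_one AE_space
  proof eventually_elim
    case (elim b)
    from elim(1) show ?case
    proof
      assume "e b = 0"
      then have "AE x in X. x \<notin> Pair b -` E"
        unfolding e_def by (intro AE_not_in null_setsI sec[OF E]) (simp add: X.emeasure_eq_measure)
      moreover have "b \<notin> E'" using \<open>e b = 0\<close> by (simp add: E'_def)
      ultimately show ?thesis by auto
    next
      assume "e b = 1"
      then have "AE x in X. x \<in> Pair b -` E" unfolding e_def using X.prob_eq_1[OF sec[OF E]] by simp
      moreover have "b \<in> E'" using \<open>e b = 1\<close> elim by (simp add: E'_def)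
      ultimately show ?thesis by auto
    qed
  qed
  moreover have "{z \<in> space (B \<Otimes>\<^sub>M X). z \<in> E \<longleftrightarrow> fst z \<in> E'} \<in> sets (B \<Otimes>\<^sub>M X)"
    by measurable
  ultimately have EE': "AE z in B \<Otimes>\<^sub>M X. z \<in> E \<longleftrightarrow> fst z \<in> E'"
    by (simp add: AE_pair_measure)
  moreover have "AE b in B. \<beta> g b \<in> E' \<longleftrightarrow> b \<in> E'" if g: "g \<in> carrier G" for g
  proof -
    have "AE z in B \<Otimes>\<^sub>M X. (\<beta> g (fst z), \<sigma> g (snd z)) \<in> E \<longleftrightarrow> \<beta> g (fst z) \<in> E'"
      using mp_map_AE[OF mp_map_pair[OF \<beta>[OF g] mp_action_mp_map[OF assms(3) g] assms(1,2)] EE'] by simp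
    with EE' inv[OF g] have "AE z in B \<Otimes>\<^sub>M X. \<beta> g (fst z) \<in> E' \<longleftrightarrow> fst z \<in> E'"
      by eventually_elim auto
    from AE_fst[OF assms(2) this assms(1)] show ?thesis .
  qed
  ultimately show ?thesis using E' by blast
qed

text \<open>Two eliminations show that \<open>E\<close> is, up to null sets, the preimage of a set
  \<open>E2\<close> in \<open>B\<close>. Over each \<open>b\<close> the hypothesis
  \<open>pos\<close> provides a square of positive measure inside the fibre of \<open>E\<close>, so
  no typical fibre is null and \<open>E2\<close> is conull.\<close>

lemma weakly_mixing_square_full:
  fixes B :: "'b measure" and X :: "'a measure"
  assumes "prob_space B" "prob_space X" "mp_action G X \<sigma>" "weakly_mixing G X \<sigma>" "group G"
    and \<beta>: "\<And>g. g \<in> carrier G \<Longrightarrow> mp_map B B (\<beta> g)"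
    and E: "E \<in> sets ((B \<Otimes>\<^sub>M X) \<Otimes>\<^sub>M X)"
    and inv: "\<And>g. g \<in> carrier G \<Longrightarrow> AE z in (B \<Otimes>\<^sub>M X) \<Otimes>\<^sub>M X.
      ((\<beta> g (fst (fst z)), \<sigma> g (snd (fst z))), \<sigma> g (snd z)) \<in> E \<longleftrightarrow> z \<in> E"
    and pos: "\<And>b. b \<in> space B \<Longrightarrow>
      \<exists>A\<in>sets X. measure X A \<noteq> 0 \<and> (\<forall>x\<in>A. \<forall>y\<in>A. ((b, x), y) \<in> E)"
  shows "AE z in (B \<Otimes>\<^sub>M X) \<Otimes>\<^sub>M X. z \<in> E"
proof -
  interpret B: prob_space B by fact
  interpret X: prob_space X by fact
  interpret P: prob_space "B \<Otimes>\<^sub>M X" using assms(1,2) by (rule prob_space_pair)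
  interpret BX: pair_sigma_finite B X ..
  interpret PX: pair_sigma_finite "B \<Otimes>\<^sub>M X" X ..
  have \<beta>2: "mp_map (B \<Otimes>\<^sub>M X) (B \<Otimes>\<^sub>M X) (\<lambda>z. (\<beta> g (fst z), \<sigma> g (snd z)))" if "g \<in> carrier G" for g
    by (intro mp_map_pair \<beta> mp_action_mp_map[OF assms(3)] that assms(1,2))
  obtain E1 where E1: "E1 \<in> sets (B \<Otimes>\<^sub>M X)" "AE z in (B \<Otimes>\<^sub>M X) \<Otimes>\<^sub>M X. z \<in> E \<longleftrightarrow> fst z \<in> E1"
    "\<forall>g\<in>carrier G. AE z in B \<Otimes>\<^sub>M X. (\<beta> g (fst z), \<sigma> g (snd z)) \<in> E1 \<longleftrightarrow> z \<in> E1"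
    using weakly_mixing_invariant_set[OF P.prob_space_axioms assms(2-5),
        of "\<lambda>g z. (\<beta> g (fst z), \<sigma> g (snd z))" E] \<beta>2 E inv by auto
  obtain E2 where E2: "E2 \<in> sets B" "AE z in B \<Otimes>\<^sub>M X. z \<in> E1 \<longleftrightarrow> fst z \<in> E2"
    using weakly_mixing_invariant_set[OF assms(1-5), of \<beta> E1] \<beta> E1(1,3) by auto
  have "AE z in (B \<Otimes>\<^sub>M X) \<Otimes>\<^sub>M X. fst z \<in> E1 \<longleftrightarrow> fst (fst z) \<in> E2"
    using mp_map_AE[OF mp_map_fst[OF assms(2) P.prob_space_axioms] E2(2)] .
  with E1(2) have E: "AE z in (B \<Otimes>\<^sub>M X) \<Otimes>\<^sub>M X. z \<in> E \<longleftrightarrow> fst (fst z) \<in> E2"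
    by eventually_elim auto
  have "AE p in B \<Otimes>\<^sub>M X. AE y in X. (p, y) \<in> E \<longleftrightarrow> fst p \<in> E2"
    using PX.AE_pair[OF E] by simp
  from BX.AE_pair[OF this]
  have "AE b in B. AE x in X. AE y in X. ((b, x), y) \<in> E \<longleftrightarrow> b \<in> E2" by simp
  with AE_space have "AE b in B. b \<in> E2"
  proof eventually_elim
    case (elim b)
    obtain A where A: "A \<in> sets X" "measure X A \<noteq> 0" "\<And>x y. x \<in> A \<Longrightarrow> y \<in> A \<Longrightarrow> ((b, x), y) \<in> E"
      using pos[OF elim(1)] by auto
    \<comment> \<open>A property that holds almost surely is met at some point of the nonnull set
      \<open>A\<close>. Using this twice finds a point of the square \<open>A \<times> A\<close> at
      which membership in \<open>E\<close> is decided by \<open>E2\<close>.\<close>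
    have ex: "\<exists>x\<in>A. Q x" if "AE x in X. Q x" for Q
    proof (rule ccontr)
      assume "\<not> ?thesis"
      with that have "AE x in X. x \<notin> A" by (auto elim: eventually_mono)
      then have "A \<in> null_sets X" using AE_iff_null_sets[OF A(1)] by simp
      then show False using A(2) by (simp add: measure_def null_sets_def)
    qed
    obtain x where x: "x \<in> A" "AE y in X. ((b, x), y) \<in> E \<longleftrightarrow> b \<in> E2" using ex[OF elim(2)] by blast
    obtain y where "y \<in> A" "((b, x), y) \<in> E \<longleftrightarrow> b \<in> E2" using ex[OF x(2)] by blast
    then show ?case using A(3) x(1) by blast
  qed
  then have "AE z in (B \<Otimes>\<^sub>M X) \<Otimes>\<^sub>M X. fst (fst z) \<in> E2"
    by (rule mp_map_AE[OF mp_map_comp[OF mp_map_fst[OF assms(2) P.prob_space_axioms] mp_map_fst[OF assms(2,1)]]])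
  with E show ?thesis by eventually_elim auto
qed

section \<open>Second countable and bi-invariant metric groups\<close>

lemma space_borel_of_topology [simp]: "space (borel_of_topology T) = topspace T"
  unfolding borel_of_topology_def by (intro space_measure_of) (auto dest: openin_subset)

lemma openin_borel_of_topology:
  assumes "openin T U"
  shows "U \<in> sets (borel_of_topology T)"
proof -
  have "sets (borel_of_topology T) = sigma_sets (topspace T) {U. openin T U}"
    unfolding borel_of_topology_def by (intro sets_measure_of) (auto dest: openin_subset)
  then show ?thesis using assms by auto
qed

lemma closedin_borel_of_topology:
  assumes "closedin T C"
  shows "C \<in> sets (borel_of_topology T)"
proof -
  have "topspace T - C \<in> sets (borel_of_topology T)"
    using assms by (intro openin_borel_of_topology) (simp add: closedin_def)
  moreover have "C = space (borel_of_topology T) - (topspace T - C)"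
    using closedin_subset[OF assms] by auto
  ultimately show ?thesis by (metis sets.compl_sets)
qed

lemma measurable_borel_of_topologyI:
  assumes "\<And>x. x \<in> space M \<Longrightarrow> f x \<in> topspace T"
    and "\<And>U. openin T U \<Longrightarrow> f -` U \<inter> space M \<in> sets M"
  shows "f \<in> M \<rightarrow>\<^sub>M borel_of_topology T"
  unfolding borel_of_topology_def using assms
  by (intro measurable_measure_of) (auto dest: openin_subset)

lemma continuous_map_measurable:
  assumes "continuous_map S T f"
  shows "f \<in> borel_of_topology S \<rightarrow>\<^sub>M borel_of_topology T"
proof (rule measurable_borel_of_topologyI)
  show "f x \<in> topspace T" if "x \<in> space (borel_of_topology S)" for x
    using assms that by (auto simp: continuous_map_def)
  fix U assume "openin T U"
  then have "openin S {x \<in> topspace S. f x \<in> U}" using assms by (auto simp: continuous_map_def)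
  moreover have "f -` U \<inter> space (borel_of_topology S) = {x \<in> topspace S. f x \<in> U}" by auto
  ultimately show "f -` U \<inter> space (borel_of_topology S) \<in> sets (borel_of_topology S)"
    using openin_borel_of_topology by metis
qed

text \<open>Second countability is what puts the open sets of the product topology into the product
  \<sigma>-algebra: each is a countable union of rectangles of basic open sets.\<close>

lemma continuous_map_prod_measurable:
  assumes "second_countable S" "second_countable T"
    and "continuous_map (prod_topology S T) U f"
  shows "f \<in> borel_of_topology S \<Otimes>\<^sub>M borel_of_topology T \<rightarrow>\<^sub>M borel_of_topology U"
proof (rule measurable_borel_of_topologyI)
  let ?P = "borel_of_topology S \<Otimes>\<^sub>M borel_of_topology T"
  have sp: "space ?P = topspace (prod_topology S T)"
    by (simp add: space_pair_measure)
  show "f x \<in> topspace U" if "x \<in> space ?P" for x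
    using assms(3) that unfolding sp by (auto simp: continuous_map_def)
  obtain \<B> where \<B>: "countable \<B>" "\<forall>V\<in>\<B>. openin S V"
    "\<forall>U x. openin S U \<and> x \<in> U \<longrightarrow> (\<exists>V\<in>\<B>. x \<in> V \<and> V \<subseteq> U)"
    using assms(1) unfolding second_countable_def by (elim exE conjE)
  obtain \<C> where \<C>: "countable \<C>" "\<forall>V\<in>\<C>. openin T V"
    "\<forall>U x. openin T U \<and> x \<in> U \<longrightarrow> (\<exists>V\<in>\<C>. x \<in> V \<and> V \<subseteq> U)"
    using assms(2) unfolding second_countable_def by (elim exE conjE)
  fix W assume "openin U W"
  then have op: "openin (prod_topology S T) (f -` W \<inter> space ?P)"
    using assms(3) unfolding sp by (auto simp: continuous_map_def vimage_def Int_def conj_commute)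
  let ?I = "{p \<in> \<B> \<times> \<C>. fst p \<times> snd p \<subseteq> f -` W \<inter> space ?P}"
  have "f -` W \<inter> space ?P = (\<Union>p\<in>?I. fst p \<times> snd p)"
  proof (intro subset_antisym subsetI)
    fix z assume "z \<in> f -` W \<inter> space ?P"
    then obtain V1 V2 where V: "openin S V1" "openin T V2" "fst z \<in> V1" "snd z \<in> V2"
        "V1 \<times> V2 \<subseteq> f -` W \<inter> space ?P"
      using op unfolding openin_prod_topology_alt by (metis prod.collapse)
    obtain B C where "B \<in> \<B>" "fst z \<in> B" "B \<subseteq> V1" "C \<in> \<C>" "snd z \<in> C" "C \<subseteq> V2"
      using \<B>(3)[rule_format, OF conjI[OF V(1,3)]] \<C>(3)[rule_format, OF conjI[OF V(2,4)]] by auto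
    then show "z \<in> (\<Union>p\<in>?I. fst p \<times> snd p)"
      using V(5) by (intro UN_I[of "(B, C)"]) (auto simp: mem_Times_iff)
  qed auto
  moreover have "countable ?I" using \<B>(1) \<C>(1) by auto
  moreover have "fst p \<times> snd p \<in> sets ?P" if "p \<in> ?I" for p
    using that \<B>(2) \<C>(2) by (auto intro!: pair_measureI openin_borel_of_topology)
  ultimately show "f -` W \<inter> space ?P \<in> sets ?P"
    by (metis (no_types, lifting) sets.countable_UN'')
qed

text \<open>The common frame for \<open>V\<close> and for the unitary group: second countability
  turns continuity of the operations into measurability of products and inverses of measurable
  functions.\<close>

locale second_countable_group = group V for V (structure) +
  fixes T
  assumes topspace_eq: "topspace T = carrier V"
    and second_countable: "second_countable T"
    and continuous_mult: "continuous_map (prod_topology T T) T (\<lambda>(x, y). x \<otimes> y)"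
    and continuous_inv: "continuous_map T T (\<lambda>x. inv x)"
begin

lemma measurable_carrier:
  assumes "f \<in> M \<rightarrow>\<^sub>M borel_of_topology T" "x \<in> space M"
  shows "f x \<in> carrier V"
  using measurable_space[OF assms] by (simp add: topspace_eq)

lemma measurable_mult [measurable (raw)]:
  assumes "f \<in> M \<rightarrow>\<^sub>M borel_of_topology T" "g \<in> M \<rightarrow>\<^sub>M borel_of_topology T"
  shows "(\<lambda>x. f x \<otimes> g x) \<in> M \<rightarrow>\<^sub>M borel_of_topology T"
  using measurable_compose[OF measurable_Pair[OF assms]
      continuous_map_prod_measurable[OF second_countable second_countable continuous_mult]]
  by simp

lemma measurable_m_inv [measurable (raw)]:
  assumes "f \<in> M \<rightarrow>\<^sub>M borel_of_topology T"
  shows "(\<lambda>x. inv (f x)) \<in> M \<rightarrow>\<^sub>M borel_of_topology T"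
  using measurable_compose[OF assms continuous_map_measurable[OF continuous_inv]] .

end

lemma polish_group_second_countable_group:
  "polish_group V T \<Longrightarrow> second_countable_group V T"
  by (simp add: polish_group_def polish_topology_def second_countable_group_def
      second_countable_group_axioms_def)

text \<open>A countable dense subset of \<open>M\<close> may miss \<open>A\<close> altogether,
  whereas a countable base restricts to every subset. So separability is first turned into second
  countability on the whole space.\<close>

lemma (in Metric_space) second_countable_subset:
  assumes "separable_space mtopology" "A \<subseteq> M"
  shows "second_countable (Metric_space.mtopology A d)"
proof -
  interpret S: Submetric M d A by unfold_locales (rule assms(2))
  obtain C where C: "countable C" "C \<subseteq> M" "mtopology closure_of C = M"
    using assms(1) unfolding separable_space_def by auto
  let ?B = "(\<lambda>(c, n). mball c (1 / real (Suc n))) ` (C \<times> UNIV)"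
  have "second_countable mtopology" unfolding second_countable_def
  proof (intro exI[of _ ?B] conjI ballI allI impI)
    show "countable ?B" using C(1) by auto
    show "openin mtopology V" if "V \<in> ?B" for V using that by auto
    fix U x assume U: "openin mtopology U \<and> x \<in> U"
    then obtain r where r: "0 < r" "mball x r \<subseteq> U" "x \<in> M"
      unfolding openin_mtopology by blast
    \<comment> \<open>The small ball is centred at a point \<open>c\<close> of the dense set rather
      than at \<open>x\<close>; half the radius leaves room for the triangle inequality.\<close>
    obtain n where n: "1 / real (Suc n) < r / 2" using nat_approx_posE[of "r / 2"] r(1) by auto
    have "x \<in> mtopology closure_of C" using C(3) r by simp
    then have "\<forall>r>0. \<exists>y\<in>C. y \<in> mball x r" unfolding metric_closure_of by simp
    then obtain c where c: "c \<in> C" "c \<in> mball x (1 / real (Suc n))"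
      by (meson of_nat_0_less_iff zero_less_Suc zero_less_divide_1_iff)
    have "x \<in> mball c (1 / real (Suc n))" using c by (auto simp: commute)
    moreover have "mball c (1 / real (Suc n)) \<subseteq> mball x r"
      using c(2) n r(3) by (intro mball_subset) (auto simp: commute)
    ultimately show "\<exists>V\<in>?B. x \<in> V \<and> V \<subseteq> U" using c(1) r(2) by (intro bexI[of _ "mball c (1 / real (Suc n))"]) auto
  qed
  then show ?thesis
    by (simp add: S.mtopology_submetric second_countable_subtopology)
qed

locale biinvariant_group = group L + Metric_space "carrier L" d for L (structure) and d +
  assumes second_countable_mtopology: "second_countable mtopology"
    and dist_left: "\<lbrakk>a \<in> carrier L; x \<in> carrier L; y \<in> carrier L\<rbrakk> \<Longrightarrow> d (a \<otimes> x) (a \<otimes> y) = d x y"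
    and dist_right: "\<lbrakk>a \<in> carrier L; x \<in> carrier L; y \<in> carrier L\<rbrakk> \<Longrightarrow> d (x \<otimes> a) (y \<otimes> a) = d x y"
begin

lemma dist_mult_le:
  assumes "a \<in> carrier L" "b \<in> carrier L" "x \<in> carrier L" "y \<in> carrier L"
  shows "d (a \<otimes> b) (x \<otimes> y) \<le> d a x + d b y"
  using triangle[of "a \<otimes> b" "x \<otimes> b" "x \<otimes> y"] assms by (simp add: dist_left dist_right)

text \<open>Multiplying by \<open>b\<close> on the left and by \<open>a\<close> on the right turns
  the pair of inverses into \<open>b\<close> and \<open>a\<close>.\<close>

lemma dist_inv:
  assumes "a \<in> carrier L" "b \<in> carrier L"
  shows "d (inv a) (inv b) = d a b"
proof -
  have "d (inv a) (inv b) = d (b \<otimes> (inv a \<otimes> a)) (b \<otimes> (inv b \<otimes> a))"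
    using assms by (simp only: dist_left dist_right inv_closed m_closed)
  also have "\<dots> = d a b" using assms by (simp add: commute m_assoc[symmetric])
  finally show ?thesis .
qed

lemma dist_one_mult_inv:
  assumes "a \<in> carrier L" "b \<in> carrier L"
  shows "d (a \<otimes> inv b) \<one> = d a b"
  using dist_right[of "inv b" a b] assms by simp

text \<open>A bi-invariant metric makes the group topological: inversion is an isometry, and
  multiplication is 1-Lipschitz for the sum of the distances by \<open>dist_mult_le\<close>.\<close>

sublocale second_countable_group L mtopology
proof
  show "topspace mtopology = carrier L" by simp
  show "second_countable mtopology" by (rule second_countable_mtopology)
  show "continuous_map mtopology mtopology (\<lambda>x. inv x)"
    unfolding continuous_map_to_metric
  proof (intro ballI allI impI)
    fix x and \<epsilon> :: real assume "x \<in> topspace mtopology" "0 < \<epsilon>"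
    then show "\<exists>U. openin mtopology U \<and> x \<in> U \<and> (\<forall>y\<in>U. inv y \<in> mball (inv x) \<epsilon>)"
      by (intro exI[of _ "mball x \<epsilon>"]) (auto simp: dist_inv)
  qed
  show "continuous_map (prod_topology mtopology mtopology) mtopology (\<lambda>(x, y). x \<otimes> y)"
    unfolding continuous_map_to_metric
  proof (intro ballI allI impI)
    fix p and \<epsilon> :: real
    assume p: "p \<in> topspace (prod_topology mtopology mtopology)" and \<epsilon>: "0 < \<epsilon>"
    obtain x y where xy: "p = (x, y)" "x \<in> carrier L" "y \<in> carrier L" using p by auto
    let ?U = "mball x (\<epsilon> / 2) \<times> mball y (\<epsilon> / 2)"
    have "openin (prod_topology mtopology mtopology) ?U" by (simp add: openin_prod_Times_iff)
    moreover have "p \<in> ?U" using xy \<epsilon> by simp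
    moreover have "(case q of (x, y) \<Rightarrow> x \<otimes> y) \<in> mball (case p of (x, y) \<Rightarrow> x \<otimes> y) \<epsilon>" if "q \<in> ?U" for q
      using that xy dist_mult_le[of x y "fst q" "snd q"] by (auto simp: split_beta)
    ultimately show "\<exists>U. openin (prod_topology mtopology mtopology) U \<and> p \<in> U \<and>
      (\<forall>y\<in>U. (case y of (x, y) \<Rightarrow> x \<otimes> y) \<in> mball (case p of (x, y) \<Rightarrow> x \<otimes> y) \<epsilon>)" by blast
  qed
qed

text \<open>Basic open sets of diameter at most \<open>e\<close> cover \<open>L\<close>, and
  countably many suffice. If all their preimages were null, the whole space would be null. This
  supplies the squares demanded by \<open>pos\<close> in
  \<open>weakly_mixing_square_full\<close>.\<close>

lemma exists_close_set:
  assumes "prob_space X" "f \<in> X \<rightarrow>\<^sub>M borel_of_topology mtopology" "0 < e"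
  shows "\<exists>A\<in>sets X. measure X A \<noteq> 0 \<and> (\<forall>x\<in>A. \<forall>y\<in>A. d (f x) (f y) < e)"
proof (rule ccontr)
  assume neg: "\<not> ?thesis"
  interpret X: prob_space X by fact
  obtain \<B> where \<B>: "countable \<B>" "\<forall>V\<in>\<B>. openin mtopology V"
    "\<forall>U x. openin mtopology U \<and> x \<in> U \<longrightarrow> (\<exists>V\<in>\<B>. x \<in> V \<and> V \<subseteq> U)"
    using second_countable_mtopology unfolding second_countable_def by (elim exE conjE)
  let ?I = "{V \<in> \<B>. \<forall>a\<in>V. \<forall>b\<in>V. d a b < e}"
  have "f -` V \<inter> space X \<in> null_sets X" if V: "V \<in> ?I" for V
  proof -
    have "f -` V \<inter> space X \<in> sets X"
      using measurable_sets[OF assms(2) openin_borel_of_topology] \<B>(2) V by auto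
    then show ?thesis using neg V by (force simp: X.emeasure_eq_measure)
  qed
  then have "(\<Union>V\<in>?I. f -` V \<inter> space X) \<in> null_sets X" using \<B>(1) by (intro null_sets_UN') auto
  also have "(\<Union>V\<in>?I. f -` V \<inter> space X) = space X"
  proof (intro subset_antisym subsetI)
    fix x assume x: "x \<in> space X"
    then have fx: "f x \<in> carrier L" by (rule measurable_carrier[OF assms(2)])
    then obtain V where V: "V \<in> \<B>" "f x \<in> V" "V \<subseteq> mball (f x) (e / 2)"
      using \<B>(3)[rule_format, of "mball (f x) (e / 2)" "f x"] assms(3) by auto
    have "d a b < e" if "a \<in> V" "b \<in> V" for a b
    proof -
      have ab: "a \<in> mball (f x) (e / 2)" "b \<in> mball (f x) (e / 2)" using that V(3) by auto
      then show ?thesis using triangle''[of a "f x" b] by simp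
    qed
    then show "x \<in> (\<Union>V\<in>?I. f -` V \<inter> space X)" using V x by auto
  qed auto
  finally show False using X.emeasure_space_1 by (simp add: null_sets_def)
qed

end

section \<open>Untwisting an intertwiner\<close>

lemma AE_ex:
  assumes "prob_space M" "AE x in M. P x"
  shows "\<exists>x\<in>space M. P x"
proof (rule ccontr)
  interpret prob_space M by fact
  assume neg: "\<not> ?thesis"
  have "AE x in M. P x \<and> x \<in> space M" using assms(2) AE_space by eventually_elim simp
  also have "(\<lambda>x. P x \<and> x \<in> space M) = (\<lambda>x. False)" using neg by auto
  finally show False by simp
qed

lemma (in group) mult_inv_cancel:
  assumes "a \<in> carrier G" "b \<in> carrier G"
  shows "a \<otimes> (inv a \<otimes> b) = b" "inv a \<otimes> (a \<otimes> b) = b"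
  using assms by (simp_all add: m_assoc[symmetric])

lemma closed_embedding_measurable:
  assumes "\<phi> \<in> closed_embedding V T U S"
  shows "\<phi> \<in> borel_of_topology T \<rightarrow>\<^sub>M borel_of_topology S"
  using assms by (intro continuous_map_measurable)
    (auto simp: closed_embedding_def embedding_map_def continuous_map_in_subtopology
      dest: homeomorphic_imp_continuous_map)

text \<open>Makes the inverse of \<open>\<phi>\<close> on its image Borel, so that a measurable
  function into the image lifts to a measurable function into \<open>V\<close>: an open set is
  mapped to a relatively open subset of a closed set.\<close>

lemma closed_embedding_image_sets:
  assumes "\<phi> \<in> closed_embedding V T U S" "topspace T = carrier V" "openin T W"
  shows "\<phi> ` W \<in> sets (borel_of_topology S)"
proof -
  have "openin (subtopology S (\<phi> ` topspace T)) (\<phi> ` W)"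
    using assms(1,3) homeomorphic_imp_open_map
    unfolding closed_embedding_def embedding_map_def open_map_def by blast
  then obtain O' where "openin S O'" "\<phi> ` W = O' \<inter> \<phi> ` carrier V"
    using assms(2) unfolding openin_subtopology by metis
  moreover have "\<phi> ` carrier V \<in> sets (borel_of_topology S)"
    using assms(1) by (intro closedin_borel_of_topology) (auto simp: closed_embedding_def)
  ultimately show ?thesis by (metis openin_borel_of_topology sets.Int)
qed

text \<open>
  The \<open>Y\<close>-coordinate comes first, and \<open>c h (s, t)\<close> stands for \<open>w (t, s, h\<^sup>-\<^sup>1)\<close>, so that the
  twisted cocycle involves \<open>h\<close> instead of \<open>g\<^sup>-\<^sup>1\<close>.
\<close>

locale intertwining = biinvariant_group L d + V: second_countable_group V TV + G: group G +
  X: prob_space X + Y: prob_space Y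
  for L :: "('l, 'p) monoid_scheme" (structure) and d
    and V :: "('v, 'q) monoid_scheme" and TV
    and G :: "('g, 'r) monoid_scheme" and X :: "'x measure" and Y :: "'y measure" +
  fixes \<sigma> \<rho> \<phi> and c :: "'g \<Rightarrow> 'y \<times> 'x \<Rightarrow> 'v" and F :: "('y \<times> 'x) \<times> 'x \<Rightarrow> 'l"
  assumes countable_G: "countable (carrier G)"
    and action_X: "mp_action G X \<sigma>"
    and weakly_mixing_X: "weakly_mixing G X \<sigma>"
    and action_Y: "mp_action G Y \<rho>"
    and \<phi>: "\<phi> \<in> closed_embedding V TV L mtopology"
    and c: "\<And>h. h \<in> carrier G \<Longrightarrow> c h \<in> Y \<Otimes>\<^sub>M X \<rightarrow>\<^sub>M borel_of_topology TV"
    and F [measurable]: "F \<in> (Y \<Otimes>\<^sub>M X) \<Otimes>\<^sub>M X \<rightarrow>\<^sub>M borel_of_topology mtopology"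
    and intertwines: "\<And>h. h \<in> carrier G \<Longrightarrow> AE p in (Y \<Otimes>\<^sub>M X) \<Otimes>\<^sub>M X.
      \<phi> (c h (fst (fst p), snd p)) = inv (F p) \<otimes> \<phi> (c h (fst p)) \<otimes>
        F ((\<rho> h (fst (fst p)), \<sigma> h (snd (fst p))), \<sigma> h (snd p))"
begin

abbreviation P1 where "P1 \<equiv> Y \<Otimes>\<^sub>M X"
abbreviation P2 where "P2 \<equiv> P1 \<Otimes>\<^sub>M X"
abbreviation P3 where "P3 \<equiv> P2 \<Otimes>\<^sub>M X"
abbreviation P4 where "P4 \<equiv> P3 \<Otimes>\<^sub>M X"

definition T1 where "T1 h p = (\<rho> h (fst p), \<sigma> h (snd p))"
definition T2 where "T2 h p = (T1 h (fst p), \<sigma> h (snd p))"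
definition T3 where "T3 h p = (T2 h (fst p), \<sigma> h (snd p))"
definition T4 where "T4 h p = (T3 h (fst p), \<sigma> h (snd p))"

lemma prob_X: "prob_space X" and prob_Y: "prob_space Y"
  by unfold_locales

lemma prob_P: "prob_space P1" "prob_space P2" "prob_space P3" "prob_space P4"
  by (intro prob_space_pair prob_X prob_Y)+

lemma mp_map_\<sigma>: "h \<in> carrier G \<Longrightarrow> mp_map X X (\<sigma> h)"
  using mp_action_mp_map[OF action_X] .

lemma mp_map_T1: "h \<in> carrier G \<Longrightarrow> mp_map P1 P1 (T1 h)"
  unfolding T1_def using mp_map_pair[OF mp_action_mp_map[OF action_Y] mp_map_\<sigma> prob_Y prob_X] .

lemma mp_map_T2: "h \<in> carrier G \<Longrightarrow> mp_map P2 P2 (T2 h)"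
  unfolding T2_def using mp_map_pair[OF mp_map_T1 mp_map_\<sigma> prob_P(1) prob_X] .

lemma mp_map_T3: "h \<in> carrier G \<Longrightarrow> mp_map P3 P3 (T3 h)"
  unfolding T3_def using mp_map_pair[OF mp_map_T2 mp_map_\<sigma> prob_P(2) prob_X] .

lemma F_closed: "p \<in> space P2 \<Longrightarrow> F p \<in> carrier L"
  using measurable_carrier[OF F] .

lemma \<phi>_hom: "\<phi> \<in> hom V L"
  using \<phi> by (simp add: closed_embedding_def)

lemma \<phi>_closed: "x \<in> carrier V \<Longrightarrow> \<phi> x \<in> carrier L"
  using hom_in_carrier[OF \<phi>_hom] .

lemma group_hom_\<phi>: "group_hom V L \<phi>"
  using \<phi>_hom by unfold_locales

lemma \<phi>_inj: "inj_on \<phi> (carrier V)"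
  using \<phi> by (metis (no_types, lifting) V.topspace_eq closed_embedding_def embedding_map_def
      homeomorphic_eq_everything_map mem_Collect_eq)

lemma c_closed: "h \<in> carrier G \<Longrightarrow> p \<in> space P1 \<Longrightarrow> c h p \<in> carrier V"
  using V.measurable_carrier[OF c] .

definition A where "A h p = \<phi> (c h p)"

lemma A_closed: "h \<in> carrier G \<Longrightarrow> p \<in> space P1 \<Longrightarrow> A h p \<in> carrier L"
  by (simp add: A_def \<phi>_closed c_closed)

lemma T2_space: "h \<in> carrier G \<Longrightarrow> p \<in> space P2 \<Longrightarrow> T2 h p \<in> space P2"
  using mp_map_T2 measurable_space mp_map_measurable by metis

lemma F_equivariant:
  assumes h: "h \<in> carrier G"
  shows "AE p in P2. F (T2 h p) = inv (A h (fst p)) \<otimes> F p \<otimes> A h (fst (fst p), snd p)"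
  using intertwines[OF h] AE_space
proof eventually_elim
  case (elim p)
  have p: "F p \<in> carrier L" "F (T2 h p) \<in> carrier L" "A h (fst p) \<in> carrier L"
    using elim(2) h by (auto intro!: F_closed A_closed T2_space simp: space_pair_measure)
  have "A h (fst (fst p), snd p) = inv (F p) \<otimes> A h (fst p) \<otimes> F (T2 h p)"
    using elim(1) by (simp add: A_def T2_def T1_def)
  then show ?case using p
    by (simp add: m_assoc mult_inv_cancel)
qed

text \<open>With \<open>q = (((s, t), t'), y)\<close> this is \<open>F ((s, t), y)\<close> times the
  inverse of \<open>F ((s, t'), y)\<close>. The variable \<open>y\<close> comes last because it is
  the one to be eliminated first.\<close>

definition K where
  "K q = F (fst (fst q), snd q) \<otimes> inv (F ((fst (fst (fst q)), snd (fst q)), snd q))"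

lemma K_measurable [measurable]: "K \<in> P3 \<rightarrow>\<^sub>M borel_of_topology mtopology"
  unfolding K_def by measurable

lemma K_closed: "q \<in> space P3 \<Longrightarrow> K q \<in> carrier L"
  using measurable_carrier[OF K_measurable] .

text \<open>The drop maps forget one \<open>X\<close>-coordinate other than the last. Pulling one
  statement back along two of them gives it at two independent points simultaneously.\<close>

lemma mp_map_drop: "mp_map P2 P1 (\<lambda>p. (fst (fst p), snd p))"
  using mp_map_comp[OF mp_map_swap_last[OF prob_Y prob_X prob_X] mp_map_fst[OF prob_X prob_P(1)]] by simp

lemma mp_map_drop3: "mp_map P3 P2 (\<lambda>p. (fst (fst p), snd p))"
  using mp_map_comp[OF mp_map_swap_last[OF prob_P(1) prob_X prob_X] mp_map_fst[OF prob_X prob_P(2)]] by simp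

lemma mp_map_drop3': "mp_map P3 P2 (\<lambda>p. ((fst (fst (fst p)), snd (fst p)), snd p))"
  using mp_map_under[OF mp_map_drop prob_P(1) prob_X] by simp

lemma mp_map_drop4: "mp_map P4 P3 (\<lambda>p. (fst (fst p), snd p))"
  using mp_map_comp[OF mp_map_swap_last[OF prob_P(2) prob_X prob_X] mp_map_fst[OF prob_X prob_P(3)]] by simp

text \<open>Both factors of \<open>K\<close> acquire the same right factor, the value of
  \<open>A h\<close> at \<open>(s, y)\<close>, and it cancels in the quotient.\<close>

lemma K_equivariant:
  assumes h: "h \<in> carrier G"
  shows "AE q in P3. K (T3 h q) =
    inv (A h (fst (fst q))) \<otimes> K q \<otimes> A h (fst (fst (fst q)), snd (fst q))"
  using mp_map_AE[OF mp_map_drop3 F_equivariant[OF h]] mp_map_AE[OF mp_map_drop3' F_equivariant[OF h]] AE_space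
proof eventually_elim
  case (elim q)
  have cl: "F (fst (fst q), snd q) \<in> carrier L" "F ((fst (fst (fst q)), snd (fst q)), snd q) \<in> carrier L"
     "A h (fst (fst q)) \<in> carrier L" "A h (fst (fst (fst q)), snd (fst q)) \<in> carrier L"
     "A h (fst (fst (fst q)), snd q) \<in> carrier L"
    using elim(3) h by (auto intro!: F_closed A_closed simp: space_pair_measure)
  have "inv a \<otimes> f \<otimes> b \<otimes> inv (inv a' \<otimes> f' \<otimes> b) = inv a \<otimes> (f \<otimes> inv f') \<otimes> a'"
    if "a \<in> carrier L" "a' \<in> carrier L" "b \<in> carrier L" "f \<in> carrier L" "f' \<in> carrier L" for a a' b f f'
  proof -
    have "b \<otimes> (inv b \<otimes> (inv f' \<otimes> a')) = inv f' \<otimes> a'" using that by (simp add: m_assoc[symmetric])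
    then show ?thesis using that by (simp add: inv_mult_group m_assoc)
  qed
  from this[OF cl(3) cl(4) cl(5) cl(1) cl(2)] show ?case
    using elim(1,2) by (simp add: K_def T3_def T2_def T1_def)
qed

lemma K_independent: "AE z in P4. K (fst z) = K (fst (fst z), snd z)"
proof -
  \<comment> \<open>Closeness is expressed by a quotient lying in a ball around the unit, so that
    measurability follows from that of the group operations. The group changes this quotient by
    conjugation, and bi-invariance makes balls around the unit conjugation invariant.\<close>
  define E where "E e = {z \<in> space P4. K (fst z) \<otimes> inv (K (fst (fst z), snd z)) \<in> mball \<one> e}" for e
  have "AE z in P4. z \<in> E e" if e: "0 < e" for e
  proof (rule weakly_mixing_square_full[OF prob_P(2) prob_X action_X weakly_mixing_X])
    show "group G" by unfold_locales
    show "mp_map P2 P2 (T2 h)" if "h \<in> carrier G" for h using mp_map_T2[OF that] .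
    have [measurable]: "mball \<one> e \<in> sets (borel_of_topology mtopology)"
      by (intro openin_borel_of_topology) simp
    show "E e \<in> sets P4" unfolding E_def by measurable
    show "AE z in P4. ((T2 h (fst (fst z)), \<sigma> h (snd (fst z))), \<sigma> h (snd z)) \<in> E e \<longleftrightarrow> z \<in> E e"
      if h: "h \<in> carrier G" for h
    proof -
      have mp4: "mp_map P4 P4 (T4 h)" unfolding T4_def
        using mp_map_pair[OF mp_map_T3[OF h] mp_map_\<sigma>[OF h] prob_P(3) prob_X] .
      show ?thesis
        using mp_map_AE[OF mp_map_fst[OF prob_X prob_P(3)] K_equivariant[OF h]]
          mp_map_AE[OF mp_map_drop4 K_equivariant[OF h]] AE_space
      proof eventually_elim
        case (elim z)
        let ?kx = "K (fst z)" and ?ky = "K (fst (fst z), snd z)"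
        let ?a = "A h (fst (fst (fst z)))" and ?b = "A h (fst (fst (fst (fst z))), snd (fst (fst z)))"
        have sp: "T4 h z \<in> space P4" using mp_map_measurable[OF mp4] elim(3) by (rule measurable_space)
        have cl: "?kx \<in> carrier L" "?ky \<in> carrier L" "?a \<in> carrier L" "?b \<in> carrier L"
          using elim(3) h by (auto intro!: K_closed A_closed simp: space_pair_measure)
        have "b \<otimes> (inv b \<otimes> (inv k' \<otimes> a)) = inv k' \<otimes> a"
          if "a \<in> carrier L" "b \<in> carrier L" "k' \<in> carrier L" for a b k'
          using that by (simp add: m_assoc[symmetric])
        then have "K (fst (T4 h z)) \<otimes> inv (K (fst (fst (T4 h z)), snd (T4 h z)))
            = inv ?a \<otimes> (?kx \<otimes> inv ?ky) \<otimes> ?a"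
          using elim(1,2) cl by (simp add: T4_def T3_def inv_mult_group m_assoc)
        moreover have "d \<one> (inv ?a \<otimes> (?kx \<otimes> inv ?ky) \<otimes> ?a) = d \<one> (?kx \<otimes> inv ?ky)"
          using dist_right[of ?a "inv ?a" "inv ?a \<otimes> (?kx \<otimes> inv ?ky)"]
            dist_left[of "inv ?a" \<one> "?kx \<otimes> inv ?ky"] cl by simp
        ultimately show ?case using sp elim(3) cl by (auto simp: E_def T4_def T3_def)
      qed
    qed
    show "\<exists>S\<in>sets X. measure X S \<noteq> 0 \<and> (\<forall>x\<in>S. \<forall>y\<in>S. ((b, x), y) \<in> E e)" if b: "b \<in> space P2" for b
    proof -
      have Kb: "(\<lambda>y. K (b, y)) \<in> X \<rightarrow>\<^sub>M borel_of_topology mtopology" using b by measurable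
      obtain S where S: "S \<in> sets X" "measure X S \<noteq> 0" "\<forall>x\<in>S. \<forall>y\<in>S. d (K (b, x)) (K (b, y)) < e"
        using exists_close_set[OF prob_X Kb e] by blast
      have "((b, x), y) \<in> E e" if xy: "x \<in> S" "y \<in> S" for x y
      proof -
        have sp: "x \<in> space X" "y \<in> space X" using xy sets.sets_into_space[OF S(1)] by auto
        then have cl: "K (b, x) \<in> carrier L" "K (b, y) \<in> carrier L"
          using b by (auto intro!: K_closed simp: space_pair_measure)
        then show ?thesis using sp b S(3) xy dist_one_mult_inv[OF cl]
          by (auto simp: E_def space_pair_measure commute)
      qed
      then show ?thesis using S(1,2) by blast
    qed
  qed
  then have "AE z in P4. \<forall>n. z \<in> E (1 / real (Suc n))"
    by (subst AE_all_countable) auto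
  then show ?thesis using AE_space
  proof eventually_elim
    case (elim z)
    have cl: "K (fst z) \<in> carrier L" "K (fst (fst z), snd z) \<in> carrier L"
      using elim(2) by (auto intro!: K_closed simp: space_pair_measure)
    have "d (K (fst z)) (K (fst (fst z), snd z)) < 1 / real (Suc n)" for n
      using elim(1)[rule_format, of n] dist_one_mult_inv[OF cl] by (simp add: E_def commute)
    then have "\<not> 0 < d (K (fst z)) (K (fst (fst z), snd z))"
      using nat_approx_posE less_asym by metis
    then show ?case using cl by simp
  qed
qed

lemma K_in_image: "AE q in P3. K q \<in> \<phi> ` carrier V"
proof -
  have closed: "closedin mtopology (\<phi> ` carrier V)" using \<phi> by (simp add: closed_embedding_def)
  \<comment> \<open>\<open>r\<close> sends \<open>(((s, y), x), x')\<close> to \<open>(((s, x), x'), y)\<close>: the variables to be eliminated come last\<close>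
  define r where "r = (\<lambda>z :: (('y \<times> 'x) \<times> 'x) \<times> 'x. (((fst (fst (fst z)), snd (fst z)), snd z), snd (fst (fst z))))"
  have r: "mp_map P3 P3 r" unfolding r_def
    using mp_map_comp[OF mp_map_under[OF mp_map_swap_last[OF prob_Y prob_X prob_X] prob_P(2) prob_X]
        mp_map_swap_last[OF prob_P(1) prob_X prob_X]] by simp
  have [measurable]: "r \<in> P3 \<rightarrow>\<^sub>M P3" using mp_map_measurable[OF r] .
  have rT: "r (T3 h z) = T3 h (r z)" for h z by (simp add: r_def T3_def T2_def T1_def)
  \<comment> \<open>The open \<open>e\<close>-neighbourhood of the image of \<open>V\<close>. As a
    union of balls it is open, hence Borel; a point lying in all of them belongs to the closure of
    the image, which is the image itself.\<close>
  define O' where "O' e = (\<Union>v\<in>carrier V. mball (\<phi> v) e)" for e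
  have O'_op: "openin mtopology (O' e)" for e unfolding O'_def by auto
  have O'_iff: "k \<in> O' e \<longleftrightarrow> (\<exists>v\<in>carrier V. d (\<phi> v) k < e)" if "k \<in> carrier L" for k e
    using that by (auto simp: O'_def \<phi>_closed)
  \<comment> \<open>The image of \<open>V\<close> is a subgroup and translations are isometries, so
    multiplication by its elements on both sides carries a nearby point of the image to another one
    at the same distance.\<close>
  have O'_shift: "inv (\<phi> a) \<otimes> k \<otimes> \<phi> b \<in> O' e"
    if sh: "k \<in> O' e" "a \<in> carrier V" "b \<in> carrier V" "k \<in> carrier L" for k a b e
  proof -
    obtain v where v: "v \<in> carrier V" "d (\<phi> v) k < e" using sh(1) unfolding O'_iff[OF sh(4)] by blast
    have \<phi>v: "\<phi> (inv\<^bsub>V\<^esub> a \<otimes>\<^bsub>V\<^esub> v \<otimes>\<^bsub>V\<^esub> b) = inv (\<phi> a) \<otimes> \<phi> v \<otimes> \<phi> b"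
      using sh v group_hom.hom_inv[OF group_hom_\<phi>] hom_mult[OF \<phi>_hom] by simp
    have "d (inv (\<phi> a) \<otimes> \<phi> v \<otimes> \<phi> b) (inv (\<phi> a) \<otimes> k \<otimes> \<phi> b) = d (\<phi> v) k"
      using sh v by (simp add: dist_left dist_right \<phi>_closed)
    then have "d (\<phi> (inv\<^bsub>V\<^esub> a \<otimes>\<^bsub>V\<^esub> v \<otimes>\<^bsub>V\<^esub> b)) (inv (\<phi> a) \<otimes> k \<otimes> \<phi> b) < e" using v \<phi>v by simp
    moreover have "inv\<^bsub>V\<^esub> a \<otimes>\<^bsub>V\<^esub> v \<otimes>\<^bsub>V\<^esub> b \<in> carrier V" "inv (\<phi> a) \<otimes> k \<otimes> \<phi> b \<in> carrier L"
      using sh v by (simp_all add: \<phi>_closed)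
    ultimately show ?thesis using O'_iff by blast
  qed
  define E where "E e = {z \<in> space P3. K (r z) \<in> O' e}" for e
  have "AE z in P3. z \<in> E e" if e: "0 < e" for e
  proof (rule weakly_mixing_square_full[OF prob_P(1) prob_X action_X weakly_mixing_X])
    show "group G" by unfold_locales
    show "mp_map P1 P1 (T1 h)" if "h \<in> carrier G" for h using mp_map_T1[OF that] .
    have [measurable]: "O' e \<in> sets (borel_of_topology mtopology)"
      by (intro openin_borel_of_topology O'_op)
    show "E e \<in> sets P3" unfolding E_def by measurable
    show "AE z in P3. ((T1 h (fst (fst z)), \<sigma> h (snd (fst z))), \<sigma> h (snd z)) \<in> E e \<longleftrightarrow> z \<in> E e"
      if h: "h \<in> carrier G" for h
      using mp_map_AE[OF r K_equivariant[OF h]] AE_space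
    proof eventually_elim
      case (elim z)
      define a b where "a = c h (fst (fst (r z)))" and "b = c h (fst (fst (fst (r z))), snd (fst (r z)))"
      have sp: "T3 h z \<in> space P3" using mp_map_measurable[OF mp_map_T3[OF h]] elim(2) by (rule measurable_space)
      have rz: "r z \<in> space P3" using elim(2) by (auto simp: r_def space_pair_measure)
      have ab: "a \<in> carrier V" "b \<in> carrier V" unfolding a_def b_def
        using rz h by (auto intro!: c_closed simp: space_pair_measure)
      have kc: "K (r z) \<in> carrier L" using K_closed[OF rz] .
      have eq: "K (r (T3 h z)) = inv (\<phi> a) \<otimes> K (r z) \<otimes> \<phi> b"
        using elim(1) by (simp add: rT a_def b_def A_def)
      have "K (r (T3 h z)) \<in> O' e \<longleftrightarrow> K (r z) \<in> O' e"
      proof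
        assume "K (r z) \<in> O' e"
        then show "K (r (T3 h z)) \<in> O' e" unfolding eq by (rule O'_shift[OF _ ab kc])
      next
        have kc': "inv (\<phi> a) \<otimes> K (r z) \<otimes> \<phi> b \<in> carrier L" using ab kc by (simp add: \<phi>_closed)
        assume "K (r (T3 h z)) \<in> O' e"
        \<comment> \<open>The converse is the same shift with the inverse elements, which undo
          \<open>a\<close> and \<open>b\<close>.\<close>
        then have "inv (\<phi> (inv\<^bsub>V\<^esub> a)) \<otimes> (inv (\<phi> a) \<otimes> K (r z) \<otimes> \<phi> b) \<otimes> \<phi> (inv\<^bsub>V\<^esub> b) \<in> O' e"
          unfolding eq using ab kc'
          by (intro O'_shift[OF _ _ _ kc']) auto
        moreover have "inv (\<phi> (inv\<^bsub>V\<^esub> a)) \<otimes> (inv (\<phi> a) \<otimes> K (r z) \<otimes> \<phi> b) \<otimes> \<phi> (inv\<^bsub>V\<^esub> b) = K (r z)"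
          using ab kc group_hom.hom_inv[OF group_hom_\<phi>]
          by (simp add: \<phi>_closed m_assoc mult_inv_cancel)
        ultimately show "K (r z) \<in> O' e" by simp
      qed
      moreover have "((T1 h (fst (fst z)), \<sigma> h (snd (fst z))), \<sigma> h (snd z)) = T3 h z"
        by (simp add: T3_def T2_def)
      ultimately show ?case using sp elim(2) by (simp add: E_def)
    qed
    show "\<exists>S\<in>sets X. measure X S \<noteq> 0 \<and> (\<forall>x\<in>S. \<forall>y\<in>S. ((b, x), y) \<in> E e)" if b: "b \<in> space P1" for b
    proof -
      obtain s y where sy: "b = (s, y)" "s \<in> space Y" "y \<in> space X" using b by (auto simp: space_pair_measure)
      \<comment> \<open>For fixed \<open>s\<close> and \<open>y\<close>, close values of
        \<open>F\<close> at \<open>x\<close> and \<open>x'\<close> have a quotient close to the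
        unit, and the unit lies in the image of \<open>V\<close>.\<close>
      have Fb: "(\<lambda>x. F ((s, x), y)) \<in> X \<rightarrow>\<^sub>M borel_of_topology mtopology" using sy by measurable
      obtain S where S: "S \<in> sets X" "measure X S \<noteq> 0" "\<forall>x\<in>S. \<forall>x'\<in>S. d (F ((s, x), y)) (F ((s, x'), y)) < e"
        using exists_close_set[OF prob_X Fb e] by blast
      have "((b, x), x') \<in> E e" if xy: "x \<in> S" "x' \<in> S" for x x'
      proof -
        have sp: "x \<in> space X" "x' \<in> space X" using xy sets.sets_into_space[OF S(1)] by auto
        then have cl: "F ((s, x), y) \<in> carrier L" "F ((s, x'), y) \<in> carrier L"
          using sy by (auto intro!: F_closed simp: space_pair_measure)
        have "K (r ((b, x), x')) = F ((s, x), y) \<otimes> inv (F ((s, x'), y))"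
          by (simp add: r_def K_def sy)
        moreover have "F ((s, x), y) \<otimes> inv (F ((s, x'), y)) \<in> O' e"
          using cl dist_one_mult_inv[OF cl] S(3) xy group_hom.hom_one[OF group_hom_\<phi>]
          by (subst O'_iff) (auto simp: commute intro!: bexI[of _ "\<one>\<^bsub>V\<^esub>"])
        ultimately show ?thesis using sp sy b by (auto simp: E_def space_pair_measure)
      qed
      then show ?thesis using S(1,2) by blast
    qed
  qed
  then have "AE z in P3. \<forall>n. z \<in> E (1 / real (Suc n))"
    by (subst AE_all_countable) auto
  then have "AE z in P3. K (r z) \<in> \<phi> ` carrier V" using AE_space
  proof eventually_elim
    case (elim z)
    have rz: "r z \<in> space P3" using elim(2) by (auto simp: r_def space_pair_measure)
    have "\<exists>y\<in>\<phi> ` carrier V. y \<in> mball (K (r z)) e" if e: "0 < e" for e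
    proof -
      obtain n where n: "1 / real (Suc n) < e" using nat_approx_posE[OF e] .
      have "K (r z) \<in> O' (1 / real (Suc n))" using elim(1) by (simp add: E_def)
      then obtain u where u: "u \<in> carrier V" "d (\<phi> u) (K (r z)) < 1 / real (Suc n)"
        unfolding O'_iff[OF K_closed[OF rz]] by (elim bexE)
      then have "\<phi> u \<in> mball (K (r z)) e"
        using n K_closed[OF rz] \<phi>_closed[OF u(1)] commute[of "\<phi> u" "K (r z)"] by simp
      then show ?thesis using u(1) by (intro bexI[of _ "\<phi> u"]) auto
    qed
    then have "K (r z) \<in> mtopology closure_of (\<phi> ` carrier V)"
      using K_closed[OF rz] by (auto simp: metric_closure_of)
    then show ?case using closed by (simp add: closure_of_closedin)
  qed
  \<comment> \<open>\<open>r'\<close> is a right inverse of \<open>r\<close>: pulling back along it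
    restores the original order of the variables.\<close>
  moreover define r' where "r' = (\<lambda>z :: (('y \<times> 'x) \<times> 'x) \<times> 'x. (((fst (fst (fst z)), snd z), snd (fst (fst z))), snd (fst z)))"
  have "mp_map P3 P3 r'" unfolding r'_def
    using mp_map_comp[OF mp_map_swap_last[OF prob_P(1) prob_X prob_X]
        mp_map_under[OF mp_map_swap_last[OF prob_Y prob_X prob_X] prob_P(2) prob_X]] by simp
  ultimately have "AE z in P3. K (r (r' z)) \<in> \<phi> ` carrier V" using mp_map_AE by blast
  then show ?thesis by (simp add: r_def r'_def)
qed

lemma untwisted:
  "\<exists>v \<in> P1 \<rightarrow>\<^sub>M borel_of_topology TV. \<exists>b. (\<forall>h\<in>carrier G. b h \<in> Y \<rightarrow>\<^sub>M borel_of_topology TV) \<and>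
    (\<forall>h\<in>carrier G. AE p in P1. b h (fst p) = inv\<^bsub>V\<^esub> (v p) \<otimes>\<^bsub>V\<^esub> c h p \<otimes>\<^bsub>V\<^esub> v (\<rho> h (fst p), \<sigma> h (snd p)))"
proof -
  have "AE z in P4. K (fst z) = K (fst (fst z), snd z) \<and> K (fst (fst z), snd z) \<in> \<phi> ` carrier V"
    using K_independent mp_map_AE[OF mp_map_drop4 K_in_image] by eventually_elim auto
  then have "AE y0 in X. AE q in P3. K q = K (fst q, y0) \<and> K (fst q, y0) \<in> \<phi> ` carrier V"
    by (intro AE_pair_swap[OF prob_P(3) prob_X]) simp
  then obtain y0 where y0: "y0 \<in> space X"
      "AE q in P3. K q = K (fst q, y0) \<and> K (fst q, y0) \<in> \<phi> ` carrier V"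
    using AE_ex[OF prob_X] by blast
  \<comment> \<open>The coordinate \<open>t'\<close> is moved to the end so that it can be frozen at
    \<open>x0\<close>, while \<open>y\<close> stays free: the computation of \<open>D\<close> needs
    \<open>K\<close> at a variable \<open>y\<close>, not only at \<open>y0\<close>.\<close>
  have "AE q in P3. K ((fst (fst q), snd q), snd (fst q)) = K ((fst (fst q), snd q), y0) \<and>
      K ((fst (fst q), snd q), y0) \<in> \<phi> ` carrier V"
    using mp_map_AE[OF mp_map_swap_last[OF prob_P(1) prob_X prob_X] y0(2)] by simp
  then have "AE x0 in X. AE p in P2. K ((fst p, x0), snd p) = K ((fst p, x0), y0) \<and>
      K ((fst p, x0), y0) \<in> \<phi> ` carrier V"
    by (intro AE_pair_swap[OF prob_P(2) prob_X]) simp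
  then obtain x0 where x0: "x0 \<in> space X" "AE p in P2. K ((fst p, x0), snd p) = K ((fst p, x0), y0) \<and>
      K ((fst p, x0), y0) \<in> \<phi> ` carrier V"
    using AE_ex[OF prob_X] by blast
  define v0 where "v0 p = K ((p, x0), y0)" for p
  have v0[measurable]: "v0 \<in> P1 \<rightarrow>\<^sub>M borel_of_topology mtopology"
    unfolding v0_def using x0(1) y0(1) by measurable
  \<comment> \<open>The unit is a default on the null set where \<open>v0\<close> misses the image.
    It keeps \<open>v\<close> in \<open>carrier V\<close> everywhere, at the price of an extra piece
    in the preimage of an open set containing the unit.\<close>
  define v where "v p = (if v0 p \<in> \<phi> ` carrier V then inv_into (carrier V) \<phi> (v0 p) else \<one>\<^bsub>V\<^esub>)" for p
  have v_closed: "v p \<in> carrier V" for p by (auto simp: v_def inv_into_into)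
  have \<phi>v: "\<phi> (v p) = v0 p" if "v0 p \<in> \<phi> ` carrier V" for p using that by (simp add: v_def f_inv_into_f)
  have im_meas[measurable]: "\<phi> ` carrier V \<in> sets (borel_of_topology mtopology)"
    using \<phi> by (intro closedin_borel_of_topology) (simp add: closed_embedding_def)
  have v: "v \<in> P1 \<rightarrow>\<^sub>M borel_of_topology TV"
  proof (rule measurable_borel_of_topologyI)
    show "v p \<in> topspace TV" for p by (simp add: V.topspace_eq v_closed)
    fix U assume U: "openin TV U"
    then have Usub: "U \<subseteq> carrier V" using openin_subset V.topspace_eq by metis
    have [measurable]: "\<phi> ` U \<in> sets (borel_of_topology mtopology)"
      using closed_embedding_image_sets[OF \<phi> V.topspace_eq U] .
    have "v -` U \<inter> space P1 = {p \<in> space P1. v0 p \<in> \<phi> ` U} \<union>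
        (if \<one>\<^bsub>V\<^esub> \<in> U then {p \<in> space P1. v0 p \<notin> \<phi> ` carrier V} else {})"
      using Usub \<phi>_inj by (auto simp: v_def f_inv_into_f inv_into_f_eq subset_iff split: if_splits)
    also have "\<dots> \<in> sets P1" by (cases "\<one>\<^bsub>V\<^esub> \<in> U") simp_all
    finally show "v -` U \<inter> space P1 \<in> sets P1" .
  qed
  have *: "AE p in P2. K ((fst p, x0), snd p) = \<phi> (v (fst p))"
    using x0(2) by eventually_elim (simp add: \<phi>v v0_def)
  define W where "W h p = inv\<^bsub>V\<^esub> (v p) \<otimes>\<^bsub>V\<^esub> c h p \<otimes>\<^bsub>V\<^esub> v (T1 h p)" for h p
  have W: "W h \<in> P1 \<rightarrow>\<^sub>M borel_of_topology TV" if h: "h \<in> carrier G" for h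
    unfolding W_def
    by (intro V.measurable_mult V.measurable_m_inv v c[OF h]
        measurable_compose[OF mp_map_measurable[OF mp_map_T1[OF h]] v])
  have W_closed: "W h p \<in> carrier V" if "h \<in> carrier G" "p \<in> space P1" for h p
    using V.measurable_carrier[OF W] that .
  have same: "AE p in P2. W h (fst p) = W h (fst (fst p), snd p)" if h: "h \<in> carrier G" for h
  proof -
    \<comment> \<open>As \<open>K\<close> does not depend on its last variable, \<open>v\<close> at
      \<open>(s, t)\<close> is computed with \<open>y\<close> and \<open>v\<close> at the translated
      point with the translate of \<open>y\<close>. This makes \<open>F_equivariant\<close>
      applicable; the values of \<open>F\<close> involving \<open>t\<close> then cancel, leaving an
      expression in \<open>(s, y)\<close>.\<close>
    define D where "D p = F ((fst p, x0), snd p) \<otimes> A h p \<otimes> inv (F ((\<rho> h (fst p), x0), \<sigma> h (snd p)))" for p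
    have D: "AE p in P2. \<phi> (W h (fst p)) = D (fst (fst p), snd p)"
      using * mp_map_AE[OF mp_map_T2[OF h] *] F_equivariant[OF h] AE_space
    proof eventually_elim
      case (elim p)
      have sp: "T2 h p \<in> space P2" using T2_space[OF h elim(4)] .
      let ?f = "F p" and ?fo = "F ((fst (fst p), x0), snd p)"
      let ?go = "F ((\<rho> h (fst (fst p)), x0), \<sigma> h (snd p))"
      let ?a = "A h (fst p)" and ?b = "A h (fst (fst p), snd p)"
      have cl: "?f \<in> carrier L" "?fo \<in> carrier L" "?go \<in> carrier L" "?a \<in> carrier L" "?b \<in> carrier L"
        using elim(4) sp h x0(1)
        by (auto intro!: F_closed A_closed simp: space_pair_measure T2_def T1_def)
      have v1: "\<phi> (v (fst p)) = ?f \<otimes> inv ?fo" using elim(1) by (simp add: K_def)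
      have v2: "\<phi> (v (T1 h (fst p))) = F (T2 h p) \<otimes> inv ?go"
        using elim(2) by (simp add: K_def T2_def T1_def)
      have cc: "c h (fst p) \<in> carrier V" using elim(4) by (intro c_closed[OF h]) (auto simp: space_pair_measure)
      have "\<phi> (W h (fst p)) = inv (\<phi> (v (fst p))) \<otimes> ?a \<otimes> \<phi> (v (T1 h (fst p)))"
        using v_closed[of "fst p"] v_closed[of "T1 h (fst p)"] cc
          group_hom.hom_inv[OF group_hom_\<phi>] hom_mult[OF \<phi>_hom]
        unfolding W_def A_def by simp
      also have "\<dots> = inv (?f \<otimes> inv ?fo) \<otimes> ?a \<otimes> (inv ?a \<otimes> ?f \<otimes> ?b \<otimes> inv ?go)"
        using v1 v2 elim(3) by simp
      also have "\<dots> = ?fo \<otimes> ?b \<otimes> inv ?go"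
        using cl by (simp add: inv_mult_group m_assoc mult_inv_cancel)
      finally show ?case by (simp add: D_def)
    qed
    \<comment> \<open>The twisted values at \<open>(s, t)\<close> and at \<open>(s, t')\<close> both
      equal \<open>D\<close> at \<open>(s, y)\<close>; the auxiliary \<open>y\<close> is discarded
      afterwards.\<close>
    have "AE q in P3. \<phi> (W h (fst (fst q))) = \<phi> (W h (fst (fst (fst q)), snd (fst q)))"
      using mp_map_AE[OF mp_map_drop3 D] mp_map_AE[OF mp_map_drop3' D] by eventually_elim simp
    from AE_fst[OF prob_X this prob_P(2)]
    have "AE p in P2. \<phi> (W h (fst p)) = \<phi> (W h (fst (fst p), snd p))" .
    then show ?thesis using AE_space
    proof eventually_elim
      case (elim p)
      then show ?case using inj_onD[OF \<phi>_inj elim(1)] W_closed[OF h] by (auto simp: space_pair_measure)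
    qed
  qed
  \<comment> \<open>Countability of the group allows one point \<open>x1\<close> to serve all
    \<open>h\<close> at once.\<close>
  have "AE p in P2. \<forall>h\<in>carrier G. W h (fst p) = W h (fst (fst p), snd p)"
    using same by (subst AE_ball_countable[OF countable_G]) auto
  then have "AE x1 in X. AE p in P1. \<forall>h\<in>carrier G. W h p = W h (fst p, x1)"
    by (intro AE_pair_swap[OF prob_P(1) prob_X]) simp
  then obtain x1 where x1: "x1 \<in> space X" "AE p in P1. \<forall>h\<in>carrier G. W h p = W h (fst p, x1)"
    using AE_ex[OF prob_X] by blast
  have "(\<lambda>s. W h (s, x1)) \<in> Y \<rightarrow>\<^sub>M borel_of_topology TV" if "h \<in> carrier G" for h
    using W[OF that] x1(1) by measurable
  moreover have "AE p in P1. W h (fst p, x1) = inv\<^bsub>V\<^esub> (v p) \<otimes>\<^bsub>V\<^esub> c h p \<otimes>\<^bsub>V\<^esub> v (\<rho> h (fst p), \<sigma> h (snd p))"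
    if "h \<in> carrier G" for h
    using x1(2) by eventually_elim (use that in \<open>simp add: W_def[symmetric] T1_def[symmetric]\<close>)
  ultimately show ?thesis by (intro bexI[OF _ v] exI[of _ "\<lambda>h s. W h (s, x1)"]) blast
qed

end

section \<open>The unitary group of a finite von Neumann algebra\<close>

lemma cinner_scaleC_right: "cinner (x :: 'h::complex_hilbert) (c *\<^sub>C y) = cnj c * cinner x y"
  by (metis cinner_commute cinner_scaleC_left complex_cnj_mult)

lemma cinner_add_right: "cinner (x :: 'h::complex_hilbert) (y + z) = cinner x y + cinner x z"
  by (metis cinner_commute cinner_add_left complex_cnj_add)

lemma norm_scaleC: "norm (c *\<^sub>C (x :: 'h::complex_hilbert)) = cmod c * norm x"
proof -
  have "(norm (c *\<^sub>C x))\<^sup>2 = Re (cinner (c *\<^sub>C x) (c *\<^sub>C x))"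
    by (simp add: Re_cinner power2_norm_eq_inner)
  also have "\<dots> = Re ((c * cnj c) * cinner x x)"
    by (simp only: cinner_scaleC_left cinner_scaleC_right mult_ac)
  also have "c * cnj c = complex_of_real ((cmod c)\<^sup>2)" by (metis complex_norm_square of_real_power)
  also have "Re (complex_of_real ((cmod c)\<^sup>2) * cinner x x) = (cmod c)\<^sup>2 * (norm x)\<^sup>2"
    by (simp add: Re_cinner power2_norm_eq_inner)
  finally show ?thesis by (simp add: power_mult_distrib[symmetric] power2_eq_iff_nonneg)
qed

text \<open>\<open>scaleC_op\<close> is built with \<open>Blinfun\<close>, which returns the
  intended operator only once bounded linearity is known; the bound comes from
  \<open>norm_scaleC\<close>.\<close>

lemma blinfun_apply_scaleC_op:
  fixes T :: "'h::complex_hilbert \<Rightarrow>\<^sub>L 'h"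
  shows "blinfun_apply (scaleC_op c T) x = c *\<^sub>C blinfun_apply T x"
proof -
  have "bounded_linear (\<lambda>x. c *\<^sub>C blinfun_apply T x)"
  proof (rule bounded_linear_intro[where K = "cmod c * norm T"])
    show "c *\<^sub>C blinfun_apply T (x + y) = c *\<^sub>C blinfun_apply T x + c *\<^sub>C blinfun_apply T y" for x y
      by (simp add: blinfun.add_right scaleC_add_right)
    show "c *\<^sub>C blinfun_apply T (r *\<^sub>R x) = r *\<^sub>R (c *\<^sub>C blinfun_apply T x)" for r x
      unfolding blinfun.scaleR_right by (metis scaleC_of_real scaleC_scaleC mult.commute)
    show "norm (c *\<^sub>C blinfun_apply T x) \<le> norm x * (cmod c * norm T)" for x
      using mult_left_mono[OF norm_blinfun[of T x], of "cmod c"] by (simp add: norm_scaleC mult_ac)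
  qed
  then show ?thesis by (simp add: scaleC_op_def bounded_linear_Blinfun_apply)
qed

lemma scaleC_op_of_real: "scaleC_op (complex_of_real r) T = r *\<^sub>R T"
  by (intro blinfun_eqI) (simp add: blinfun_apply_scaleC_op scaleC_of_real blinfun.scaleR_left)

text \<open>Gives the definite description in \<open>adj\<close> its meaning; existence inside
  \<open>N\<close> is part of the definition of a von Neumann algebra.\<close>

lemma is_adjoint_unique:
  fixes T :: "'h::complex_hilbert \<Rightarrow>\<^sub>L 'h"
  assumes "is_adjoint T S" "is_adjoint T S'"
  shows "S = S'"
proof (rule blinfun_eqI)
  fix y
  let ?z = "blinfun_apply S y - blinfun_apply S' y"
  have "cinner ?z (blinfun_apply S y) = cinner ?z (blinfun_apply S' y)"
    using assms unfolding is_adjoint_def by metis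
  then have "inner ?z (blinfun_apply S y) = inner ?z (blinfun_apply S' y)"
    by (metis Re_cinner)
  then have "inner ?z ?z = 0" by (simp add: inner_diff_right)
  then show "blinfun_apply S y = blinfun_apply S' y" by simp
qed

lemma adj_eqI: "is_adjoint T S \<Longrightarrow> adj T = S"
  unfolding adj_def using is_adjoint_unique by blast

lemma is_adjoint_sym: "is_adjoint T S \<Longrightarrow> is_adjoint S T"
  unfolding is_adjoint_def by (metis cinner_commute)

lemma is_adjoint_compose:
  "is_adjoint S S' \<Longrightarrow> is_adjoint T T' \<Longrightarrow> is_adjoint (S o\<^sub>L T) (T' o\<^sub>L S')"
  by (simp add: is_adjoint_def)

lemma is_adjoint_add:
  "is_adjoint S S' \<Longrightarrow> is_adjoint T T' \<Longrightarrow> is_adjoint (S + T) (S' + T')"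
  by (simp add: is_adjoint_def blinfun.add_left cinner_add_left cinner_add_right)

lemma is_adjoint_scaleR:
  "is_adjoint T T' \<Longrightarrow> is_adjoint (r *\<^sub>R T) (r *\<^sub>R T')"
  by (simp add: is_adjoint_def blinfun.scaleR_left scaleC_of_real[symmetric] cinner_scaleC_left
      cinner_scaleC_right)

lemma is_adjoint_id: "is_adjoint id_blinfun id_blinfun"
  by (simp add: is_adjoint_def)

section \<open>The trace norm and its bi-invariance\<close>

locale finite_vN =
  fixes N :: "('h::complex_hilbert \<Rightarrow>\<^sub>L 'h) set" and \<tau>
  assumes vN: "separable_finite_vN N \<tau>"
begin

lemma vNa: "von_neumann_algebra N" and tr: "tracial_state N \<tau>" and faith: "faithful_on N \<tau>"
  using vN by (auto simp: separable_finite_vN_def)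

lemma N_add: "S \<in> N \<Longrightarrow> T \<in> N \<Longrightarrow> S + T \<in> N"
  and N_comp: "S \<in> N \<Longrightarrow> T \<in> N \<Longrightarrow> S o\<^sub>L T \<in> N"
  and N_id: "id_blinfun \<in> N"
  and N_adj: "T \<in> N \<Longrightarrow> \<exists>S\<in>N. is_adjoint T S"
  using vNa by (auto simp: von_neumann_algebra_def)

lemma N_scaleR: "T \<in> N \<Longrightarrow> r *\<^sub>R T \<in> N"
  using vNa unfolding von_neumann_algebra_def by (metis scaleC_op_of_real)

lemma N_diff: "S \<in> N \<Longrightarrow> T \<in> N \<Longrightarrow> S - T \<in> N"
  using N_add[of S "(-1) *\<^sub>R T"] N_scaleR[of T "-1"] by simp

lemma adj_is_adjoint: "T \<in> N \<Longrightarrow> is_adjoint T (adj T)" and adj_N: "T \<in> N \<Longrightarrow> adj T \<in> N"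
  using N_adj adj_eqI by metis+

lemma adj_adj: "T \<in> N \<Longrightarrow> adj (adj T) = T"
  using adj_eqI[OF is_adjoint_sym[OF adj_is_adjoint]] .

lemma adj_comp: "S \<in> N \<Longrightarrow> T \<in> N \<Longrightarrow> adj (S o\<^sub>L T) = adj T o\<^sub>L adj S"
  by (intro adj_eqI is_adjoint_compose adj_is_adjoint)

lemma adj_add: "S \<in> N \<Longrightarrow> T \<in> N \<Longrightarrow> adj (S + T) = adj S + adj T"
  by (intro adj_eqI is_adjoint_add adj_is_adjoint)

lemma adj_scaleR: "T \<in> N \<Longrightarrow> adj (r *\<^sub>R T) = r *\<^sub>R adj T"
  by (intro adj_eqI is_adjoint_scaleR adj_is_adjoint)

lemma adj_id: "adj id_blinfun = id_blinfun"
  by (intro adj_eqI is_adjoint_id)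

lemma tr_add: "S \<in> N \<Longrightarrow> T \<in> N \<Longrightarrow> \<tau> (S + T) = \<tau> S + \<tau> T"
  and tr_comm: "S \<in> N \<Longrightarrow> T \<in> N \<Longrightarrow> \<tau> (S o\<^sub>L T) = \<tau> (T o\<^sub>L S)"
  and tr_pos: "T \<in> N \<Longrightarrow> \<tau> (adj T o\<^sub>L T) \<in> \<real>\<^sub>\<ge>\<^sub>0"
  using tr by (auto simp: tracial_state_def)

lemma tr_scaleR: "T \<in> N \<Longrightarrow> \<tau> (r *\<^sub>R T) = complex_of_real r * \<tau> T"
  using tr unfolding tracial_state_def by (metis scaleC_op_of_real)

definition norm2sq where "norm2sq T = Re (\<tau> (adj T o\<^sub>L T))"

lemma norm2sq_nonneg: "T \<in> N \<Longrightarrow> 0 \<le> norm2sq T"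
  using tr_pos[of T] by (auto simp: norm2sq_def complex_nonneg_Reals_iff)

lemma norm2sq_eq_0: "T \<in> N \<Longrightarrow> norm2sq T = 0 \<Longrightarrow> T = 0"
  using tr_pos[of T] faith unfolding norm2sq_def faithful_on_def
  by (auto simp: complex_nonneg_Reals_iff complex_eq_iff)

lemma norm2sq_scaleR: "T \<in> N \<Longrightarrow> norm2sq (r *\<^sub>R T) = r\<^sup>2 * norm2sq T"
  by (simp add: norm2sq_def adj_scaleR bounded_bilinear.scaleR_left[OF bounded_bilinear_blinfun_compose] bounded_bilinear.scaleR_right[OF bounded_bilinear_blinfun_compose]
      tr_scaleR N_comp N_scaleR adj_N power2_eq_square)

lemma norm2sq_add:
  assumes "S \<in> N" "T \<in> N"
  shows "norm2sq (S + T) = norm2sq S + norm2sq T + Re (\<tau> (adj S o\<^sub>L T) + \<tau> (adj T o\<^sub>L S))"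
  using assms
  by (simp add: norm2sq_def adj_add bounded_bilinear.add_left[OF bounded_bilinear_blinfun_compose] bounded_bilinear.add_right[OF bounded_bilinear_blinfun_compose]
      tr_add N_comp N_add adj_N)

lemma norm2sq_lincomb:
  assumes "S \<in> N" "T \<in> N"
  shows "norm2sq (r *\<^sub>R S + t *\<^sub>R T) = r\<^sup>2 * norm2sq S + t\<^sup>2 * norm2sq T +
    r * t * Re (\<tau> (adj S o\<^sub>L T) + \<tau> (adj T o\<^sub>L S))"
proof -
  have "adj (r *\<^sub>R S) o\<^sub>L (t *\<^sub>R T) = (r * t) *\<^sub>R (adj S o\<^sub>L T)"
    "adj (t *\<^sub>R T) o\<^sub>L (r *\<^sub>R S) = (r * t) *\<^sub>R (adj T o\<^sub>L S)"
    using assms by (simp_all add: adj_scaleR bounded_bilinear.scaleR_left[OF bounded_bilinear_blinfun_compose]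
        bounded_bilinear.scaleR_right[OF bounded_bilinear_blinfun_compose])
  then show ?thesis
    using assms by (simp add: norm2sq_add norm2sq_scaleR N_scaleR tr_scaleR N_comp adj_N algebra_simps)
qed

lemma sqrt_norm2sq_triangle:
  assumes S: "S \<in> N" and T: "T \<in> N"
  shows "sqrt (norm2sq (S + T)) \<le> sqrt (norm2sq S) + sqrt (norm2sq T)"
proof (cases "norm2sq S = 0 \<or> norm2sq T = 0")
  case True
  then show ?thesis using norm2sq_eq_0[OF S] norm2sq_eq_0[OF T] norm2sq_nonneg[OF S] norm2sq_nonneg[OF T] by auto
next
  case False
  define \<alpha> \<beta> where "\<alpha> = sqrt (norm2sq S)" and "\<beta> = sqrt (norm2sq T)"
  define b where "b = Re (\<tau> (adj S o\<^sub>L T) + \<tau> (adj T o\<^sub>L S))"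
  have sq: "\<alpha>\<^sup>2 = norm2sq S" "\<beta>\<^sup>2 = norm2sq T" using S T by (auto simp: \<alpha>_def \<beta>_def norm2sq_nonneg)
  have pos: "0 < \<alpha>" "0 < \<beta>" using False norm2sq_nonneg[OF S] norm2sq_nonneg[OF T]
    by (auto simp: \<alpha>_def \<beta>_def)
  \<comment> \<open>Cauchy-Schwarz: with the coefficients \<open>\<beta>\<close> and
    \<open>-\<alpha>\<close> both square terms agree and \<open>\<alpha> * \<beta>\<close> factors
    out. The case of a vanishing norm was split off so that this factor is positive.\<close>
  have "0 \<le> norm2sq (\<beta> *\<^sub>R S + (-\<alpha>) *\<^sub>R T)" using S T by (intro norm2sq_nonneg N_add N_scaleR)
  also have "\<dots> = \<beta>\<^sup>2 * \<alpha>\<^sup>2 + (-\<alpha>)\<^sup>2 * \<beta>\<^sup>2 + \<beta> * (-\<alpha>) * b"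
    unfolding norm2sq_lincomb[OF S T] sq b_def ..
  also have "\<dots> = \<alpha> * \<beta> * (2 * \<alpha> * \<beta> - b)" by (simp add: power2_eq_square algebra_simps)
  finally have "0 \<le> \<alpha> * \<beta> * (2 * \<alpha> * \<beta> - b)" .
  then have "b \<le> 2 * \<alpha> * \<beta>"
    using zero_le_mult_iff[of "\<alpha> * \<beta>" "2 * \<alpha> * \<beta> - b"] mult_pos_pos[OF pos] by linarith
  then have "norm2sq (S + T) \<le> (\<alpha> + \<beta>)\<^sup>2"
    using norm2sq_add[OF S T] sq by (simp add: b_def power2_sum)
  then show ?thesis using pos by (simp add: real_le_lsqrt \<alpha>_def[symmetric] \<beta>_def[symmetric])
qed

lemma dist2_eq: "S \<in> N \<Longrightarrow> T \<in> N \<Longrightarrow> dist2 N \<tau> S T = sqrt (norm2sq (S - T))"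
  by (simp add: dist2_def norm2sq_def)

lemma metric_dist2: "Metric_space N (dist2 N \<tau>)"
proof
  show "0 \<le> dist2 N \<tau> S T" for S T
    using norm2sq_nonneg[OF N_diff] by (auto simp: dist2_def norm2sq_def)
  show "dist2 N \<tau> S T = dist2 N \<tau> T S" for S T
  proof (cases "S \<in> N \<and> T \<in> N")
    case True
    then have "norm2sq ((-1) *\<^sub>R (S - T)) = norm2sq (S - T)" by (simp only: norm2sq_scaleR N_diff) simp
    then show ?thesis using True by (simp add: dist2_eq)
  qed (auto simp: dist2_def)
  show "dist2 N \<tau> S T = 0 \<longleftrightarrow> S = T" if "S \<in> N" "T \<in> N" for S T
    using that norm2sq_eq_0[OF N_diff, of S T] norm2sq_scaleR[of S 0] by (auto simp: dist2_eq)
  show "dist2 N \<tau> S R \<le> dist2 N \<tau> S T + dist2 N \<tau> T R" if "S \<in> N" "T \<in> N" "R \<in> N" for S T R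
    using sqrt_norm2sq_triangle[of "S - T" "T - R"] that by (simp add: dist2_eq N_diff)
qed

lemma carrier_unitary:
  "U \<in> carrier (unitary_group N) \<longleftrightarrow> U \<in> N \<and> adj U o\<^sub>L U = id_blinfun \<and> U o\<^sub>L adj U = id_blinfun"
  by (simp add: unitary_group_def)

lemma id_blinfun_compose [simp]: "id_blinfun o\<^sub>L T = T" "T o\<^sub>L id_blinfun = T"
  by (auto intro: blinfun_eqI)

lemma blinfun_comp_assoc: "(R o\<^sub>L S) o\<^sub>L T = R o\<^sub>L (S o\<^sub>L T)"
  by (auto intro: blinfun_eqI)

lemma blinfun_comp_cancel: "R o\<^sub>L S = id_blinfun \<Longrightarrow> R o\<^sub>L (S o\<^sub>L T) = T"
  by (metis blinfun_comp_assoc id_blinfun_compose(1))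

lemma group_unitary: "group (unitary_group N)"
proof (rule groupI)
  show "x \<otimes>\<^bsub>unitary_group N\<^esub> y \<in> carrier (unitary_group N)"
    if "x \<in> carrier (unitary_group N)" "y \<in> carrier (unitary_group N)" for x y
    using that by (simp add: unitary_group_def N_comp adj_comp blinfun_comp_assoc blinfun_comp_cancel)
  show "\<one>\<^bsub>unitary_group N\<^esub> \<in> carrier (unitary_group N)"
    by (simp add: unitary_group_def N_id adj_id)
  show "x \<otimes>\<^bsub>unitary_group N\<^esub> y \<otimes>\<^bsub>unitary_group N\<^esub> z = x \<otimes>\<^bsub>unitary_group N\<^esub> (y \<otimes>\<^bsub>unitary_group N\<^esub> z)" for x y z
    by (simp add: unitary_group_def blinfun_comp_assoc)
  show "\<one>\<^bsub>unitary_group N\<^esub> \<otimes>\<^bsub>unitary_group N\<^esub> x = x" for x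
    by (simp add: unitary_group_def)
  show "\<exists>y\<in>carrier (unitary_group N). y \<otimes>\<^bsub>unitary_group N\<^esub> x = \<one>\<^bsub>unitary_group N\<^esub>"
    if "x \<in> carrier (unitary_group N)" for x
    using that by (intro bexI[of _ "adj x"]) (auto simp: unitary_group_def adj_N adj_adj)
qed

text \<open>Left invariance holds because \<open>adj a o\<^sub>L a\<close> cancels between the two
  factors under the trace. Right invariance is where traciality is used: it moves
  \<open>adj a\<close> to the far end, next to \<open>a\<close>.\<close>

lemma biinvariant_unitary_group: "biinvariant_group (unitary_group N) (dist2 N \<tau>)"
proof -
  have sub: "carrier (unitary_group N) \<subseteq> N" by (auto simp: carrier_unitary)
  interpret NM: Metric_space N "dist2 N \<tau>" by (rule metric_dist2)
  interpret Metric_space "carrier (unitary_group N)" "dist2 N \<tau>" using sub by (rule NM.subspace)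
  interpret group "unitary_group N" by (rule group_unitary)
  show ?thesis
  proof
    show "second_countable mtopology"
      using vN sub by (intro NM.second_countable_subset) (auto simp: separable_finite_vN_def)
    fix a x y assume a: "a \<in> carrier (unitary_group N)" and xy: "x \<in> carrier (unitary_group N)" "y \<in> carrier (unitary_group N)"
    then have N: "a \<in> N" "x \<in> N" "y \<in> N" using sub by auto
    let ?D = "x - y"
    have D: "?D \<in> N" using N by (intro N_diff)
    have "norm2sq (a o\<^sub>L ?D) = norm2sq ?D"
      using a N D by (simp add: norm2sq_def adj_comp carrier_unitary blinfun_comp_assoc blinfun_comp_cancel)
    then show "dist2 N \<tau> (a \<otimes>\<^bsub>unitary_group N\<^esub> x) (a \<otimes>\<^bsub>unitary_group N\<^esub> y) = dist2 N \<tau> x y"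
      using N by (simp add: unitary_group_def dist2_eq N_comp bounded_bilinear.diff_right[OF bounded_bilinear_blinfun_compose])
    have "norm2sq (?D o\<^sub>L a) = Re (\<tau> (adj a o\<^sub>L (adj ?D o\<^sub>L (?D o\<^sub>L a))))"
      using N D by (simp add: norm2sq_def adj_comp blinfun_comp_assoc)
    also have "\<dots> = Re (\<tau> ((adj ?D o\<^sub>L (?D o\<^sub>L a)) o\<^sub>L adj a))"
      using N D by (subst tr_comm) (auto intro!: N_comp adj_N)
    also have "\<dots> = norm2sq ?D"
      using a by (simp add: norm2sq_def carrier_unitary blinfun_comp_assoc)
    finally show "dist2 N \<tau> (x \<otimes>\<^bsub>unitary_group N\<^esub> a) (y \<otimes>\<^bsub>unitary_group N\<^esub> a) = dist2 N \<tau> x y"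
      using N by (simp add: unitary_group_def dist2_eq N_comp bounded_bilinear.diff_left[OF bounded_bilinear_blinfun_compose])
  qed
qed

end

section \<open>Cohomology of cocycles\<close>

lemma mp_action_compose:
  assumes "mp_action G M a" "g \<in> carrier G" "h \<in> carrier G" "x \<in> space M"
  shows "a (g \<otimes>\<^bsub>G\<^esub> h) x = a g (a h x)"
  using assms group_action.composition_rule[of G "space M" a x g h] by (simp add: mp_action_def)

lemma mp_action_space:
  assumes "mp_action G M a" "g \<in> carrier G" "x \<in> space M"
  shows "a g x \<in> space M"
  using measurable_space[OF mp_map_measurable[OF mp_action_mp_map[OF assms(1,2)]] assms(3)] .

lemma diag_action_apply:
  "p \<in> space (M \<Otimes>\<^sub>M N) \<Longrightarrow> diag_action M a N b g p = (a g (fst p), b g (snd p))"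
  by (simp add: diag_action_def)

lemma cocycles_measurable:
  assumes "w \<in> cocycles G M a V T" "g \<in> carrier G"
  shows "(\<lambda>p. w (p, g)) \<in> M \<rightarrow>\<^sub>M borel_of_topology T"
proof -
  have [measurable]: "w \<in> M \<Otimes>\<^sub>M count_space (carrier G) \<rightarrow>\<^sub>M borel_of_topology T"
    using assms(1) by (simp add: cocycles_def)
  have "g \<in> space (count_space (carrier G))" using assms(2) by simp
  then show ?thesis by measurable
qed

text \<open>If \<open>u\<close> carries \<open>w\<close> to \<open>w1\<close>, and \<open>w1\<close>
  agrees along two equivariant maps, then \<open>u\<close> at \<open>\<pi>\<close> times the inverse
  of \<open>u\<close> at \<open>\<pi>'\<close> is a transfer function between the two pullbacks.
  With two coordinate projections this is the converse direction, both for products and for group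
  morphisms.\<close>

lemma cohomologous_pullback:
  assumes "second_countable_group V T" "group G"
    and "cohomologous G P a V T w w1"
    and w: "\<And>g p. g \<in> carrier G \<Longrightarrow> p \<in> space P \<Longrightarrow> w (p, g) \<in> carrier V"
    and a: "\<And>g p. g \<in> carrier G \<Longrightarrow> p \<in> space P \<Longrightarrow> a g p \<in> space P"
    and \<pi>: "mp_map Z P \<pi>" "mp_map Z P \<pi>'"
    and equiv: "\<And>g z. g \<in> carrier G \<Longrightarrow> z \<in> space Z \<Longrightarrow> \<pi> (b g z) = a g (\<pi> z)"
      "\<And>g z. g \<in> carrier G \<Longrightarrow> z \<in> space Z \<Longrightarrow> \<pi>' (b g z) = a g (\<pi>' z)"
    and eq: "\<And>g z. g \<in> carrier G \<Longrightarrow> z \<in> space Z \<Longrightarrow> w1 (\<pi> z, g) = w1 (\<pi>' z, g)"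
  shows "cohomologous G Z b V T (\<lambda>(z, g). w (\<pi> z, g)) (\<lambda>(z, g). w (\<pi>' z, g))"
proof -
  interpret V: second_countable_group V T by fact
  interpret G: group G by fact
  obtain u where u: "u \<in> P \<rightarrow>\<^sub>M borel_of_topology T" and
    co: "\<And>g. g \<in> carrier G \<Longrightarrow> AE t in P.
      w1 (t, g) = inv\<^bsub>V\<^esub> (u t) \<otimes>\<^bsub>V\<^esub> w (t, g) \<otimes>\<^bsub>V\<^esub> u (a (inv\<^bsub>G\<^esub> g) t)"
    using assms(3) unfolding cohomologous_def by blast
  have uc: "u p \<in> carrier V" if "p \<in> space P" for p using V.measurable_carrier[OF u that] .
  define u' where "u' z = u (\<pi> z) \<otimes>\<^bsub>V\<^esub> inv\<^bsub>V\<^esub> (u (\<pi>' z))" for z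
  have "u' \<in> Z \<rightarrow>\<^sub>M borel_of_topology T" unfolding u'_def
    by (intro V.measurable_mult V.measurable_m_inv measurable_compose[OF mp_map_measurable u] \<pi>)
  moreover have "AE z in Z. w (\<pi>' z, g) =
      inv\<^bsub>V\<^esub> (u' z) \<otimes>\<^bsub>V\<^esub> w (\<pi> z, g) \<otimes>\<^bsub>V\<^esub> u' (b (inv\<^bsub>G\<^esub> g) z)" if g: "g \<in> carrier G" for g
    using mp_map_AE[OF \<pi>(1) co[OF g]] mp_map_AE[OF \<pi>(2) co[OF g]] AE_space
  proof eventually_elim
    case (elim z)
    let ?h = "inv\<^bsub>G\<^esub> g"
    have h: "?h \<in> carrier G" using g by simp
    have sp: "\<pi> z \<in> space P" "\<pi>' z \<in> space P"
      using elim(3) measurable_space mp_map_measurable \<pi> by metis+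
    have cl: "u (\<pi> z) \<in> carrier V" "u (\<pi>' z) \<in> carrier V" "u (a ?h (\<pi> z)) \<in> carrier V"
      "u (a ?h (\<pi>' z)) \<in> carrier V" "w (\<pi> z, g) \<in> carrier V" "w (\<pi>' z, g) \<in> carrier V"
      using sp g h by (auto intro!: uc w a)
    have "inv\<^bsub>V\<^esub> (u' z) \<otimes>\<^bsub>V\<^esub> w (\<pi> z, g) \<otimes>\<^bsub>V\<^esub> u' (b ?h z)
      = u (\<pi>' z) \<otimes>\<^bsub>V\<^esub> (inv\<^bsub>V\<^esub> (u (\<pi> z)) \<otimes>\<^bsub>V\<^esub> w (\<pi> z, g) \<otimes>\<^bsub>V\<^esub> u (a ?h (\<pi> z)))
        \<otimes>\<^bsub>V\<^esub> inv\<^bsub>V\<^esub> (u (a ?h (\<pi>' z)))"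
      using cl by (simp add: u'_def equiv h elim(3) V.inv_mult_group V.m_assoc)
    also have "\<dots> = u (\<pi>' z) \<otimes>\<^bsub>V\<^esub> (inv\<^bsub>V\<^esub> (u (\<pi>' z)) \<otimes>\<^bsub>V\<^esub> w (\<pi>' z, g) \<otimes>\<^bsub>V\<^esub> u (a ?h (\<pi>' z)))
        \<otimes>\<^bsub>V\<^esub> inv\<^bsub>V\<^esub> (u (a ?h (\<pi>' z)))"
      using elim(1,2) eq[OF g elim(3)] by simp
    also have "\<dots> = w (\<pi>' z, g)" using cl by (simp add: V.m_assoc V.mult_inv_cancel)
    finally show ?case ..
  qed
  ultimately show ?thesis unfolding cohomologous_def by auto
qed

text \<open>Passes to the coordinates of the locale \<open>intertwining\<close> and back:
  \<open>\<kappa>\<close> moves the \<open>Y\<close>-coordinate from the front to the end. The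
  family \<open>b\<close> yields a cocycle because twisting by \<open>U\<close> preserves the
  cocycle identity.\<close>

lemma untwist_of_intertwiner:
  fixes w :: "('x \<times> 'y) \<times> 'g \<Rightarrow> 'v"
  assumes "group G" "countable (carrier G)"
    and "prob_space X" "mp_action G X \<sigma>" "weakly_mixing G X \<sigma>"
    and "prob_space Y" "mp_action G Y \<rho>"
    and "second_countable_group V TV" "biinvariant_group L d"
    and \<phi>: "\<phi> \<in> closed_embedding V TV L (Metric_space.mtopology (carrier L) d)"
    and w: "w \<in> cocycles G (X \<Otimes>\<^sub>M Y) (diag_action X \<sigma> Y \<rho>) V TV"
    and co: "cohomologous G ((X \<Otimes>\<^sub>M X) \<Otimes>\<^sub>M Y) (diag_action (X \<Otimes>\<^sub>M X) (diag_action X \<sigma> X \<sigma>) Y \<rho>)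
      L (Metric_space.mtopology (carrier L) d)
      (\<phi> \<circ> (\<lambda>(((t1, t2), s), g). w ((t1, s), g))) (\<phi> \<circ> (\<lambda>(((t1, t2), s), g). w ((t2, s), g)))"
  shows "\<exists>w0 \<in> cocycles G Y \<rho> V TV.
    cohomologous G (X \<Otimes>\<^sub>M Y) (diag_action X \<sigma> Y \<rho>) V TV w (\<lambda>((t, s), g). w0 (s, g))"
proof -
  interpret G: group G by fact
  interpret X: prob_space X by fact
  interpret Y: prob_space Y by fact
  interpret V: second_countable_group V TV by fact
  interpret L: biinvariant_group L d by fact
  let ?XY = "X \<Otimes>\<^sub>M Y" and ?YX = "Y \<Otimes>\<^sub>M X" and ?Z = "(Y \<Otimes>\<^sub>M X) \<Otimes>\<^sub>M X" and ?a = "diag_action X \<sigma> Y \<rho>"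
  obtain u where u[measurable]: "u \<in> (X \<Otimes>\<^sub>M X) \<Otimes>\<^sub>M Y \<rightarrow>\<^sub>M borel_of_topology L.mtopology" and
    uco: "\<And>g. g \<in> carrier G \<Longrightarrow> AE t in (X \<Otimes>\<^sub>M X) \<Otimes>\<^sub>M Y.
      (\<phi> \<circ> (\<lambda>(((t1, t2), s), g). w ((t2, s), g))) (t, g) =
      inv\<^bsub>L\<^esub> (u t) \<otimes>\<^bsub>L\<^esub> (\<phi> \<circ> (\<lambda>(((t1, t2), s), g). w ((t1, s), g))) (t, g) \<otimes>\<^bsub>L\<^esub>
        u (diag_action (X \<Otimes>\<^sub>M X) (diag_action X \<sigma> X \<sigma>) Y \<rho> (inv\<^bsub>G\<^esub> g) t)"
    using co unfolding cohomologous_def by blast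
  have XX: "prob_space (X \<Otimes>\<^sub>M X)" and YX: "prob_space ?YX" and XY: "prob_space ?XY"
    by (intro prob_space_pair assms)+
  define \<kappa> where "\<kappa> = (\<lambda>p :: ('y \<times> 'x) \<times> 'x. ((snd (fst p), snd p), fst (fst p)))"
  have \<kappa>: "mp_map ?Z ((X \<Otimes>\<^sub>M X) \<Otimes>\<^sub>M Y) \<kappa>" unfolding \<kappa>_def
    using mp_map_comp[OF mp_map_assoc[OF assms(6,3,3)] mp_map_swap[OF assms(6) XX]] by simp
  note [measurable] = mp_map_measurable[OF \<kappa>]
  have wg: "(\<lambda>p. w (p, g)) \<in> ?XY \<rightarrow>\<^sub>M borel_of_topology TV" if "g \<in> carrier G" for g
    using cocycles_measurable[OF w that] .
  define c where "c h p = w ((snd p, fst p), inv\<^bsub>G\<^esub> h)" for h and p :: "'y \<times> 'x"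
  have swap: "mp_map ?XY ?YX (\<lambda>p. (snd p, fst p))" "mp_map ?YX ?XY (\<lambda>p. (snd p, fst p))"
    using assms by (auto intro: mp_map_swap)
  interpret I: intertwining L d V TV G X Y \<sigma> \<rho> \<phi> c "\<lambda>p. u (\<kappa> p)"
  proof
    show "countable (carrier G)" "mp_action G X \<sigma>" "weakly_mixing G X \<sigma>" "mp_action G Y \<rho>"
      "\<phi> \<in> closed_embedding V TV L L.mtopology" by fact+
    show "c h \<in> ?YX \<rightarrow>\<^sub>M borel_of_topology TV" if "h \<in> carrier G" for h
      unfolding c_def using measurable_compose[OF mp_map_measurable[OF swap(2)] wg[of "inv\<^bsub>G\<^esub> h"]] that by simp
    show "(\<lambda>p. u (\<kappa> p)) \<in> ?Z \<rightarrow>\<^sub>M borel_of_topology L.mtopology" by measurable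
    show "AE p in ?Z. \<phi> (c h (fst (fst p), snd p)) = inv\<^bsub>L\<^esub> (u (\<kappa> p)) \<otimes>\<^bsub>L\<^esub> \<phi> (c h (fst p)) \<otimes>\<^bsub>L\<^esub>
        u (\<kappa> ((\<rho> h (fst (fst p)), \<sigma> h (snd (fst p))), \<sigma> h (snd p)))" if h: "h \<in> carrier G" for h
      using mp_map_AE[OF \<kappa> uco[OF G.inv_closed[OF h]]] AE_space
    proof eventually_elim
      case (elim p)
      then have "\<kappa> p \<in> space ((X \<Otimes>\<^sub>M X) \<Otimes>\<^sub>M Y)" "(snd (fst p), snd p) \<in> space (X \<Otimes>\<^sub>M X)"
        by (auto simp: \<kappa>_def space_pair_measure)
      then show ?case using elim(1) h by (simp add: c_def \<kappa>_def diag_action_apply)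
    qed
  qed
  obtain v b where v: "v \<in> ?YX \<rightarrow>\<^sub>M borel_of_topology TV"
    and "\<forall>h\<in>carrier G. b h \<in> Y \<rightarrow>\<^sub>M borel_of_topology TV"
    and "\<forall>h\<in>carrier G. AE p in ?YX. b h (fst p) =
      inv\<^bsub>V\<^esub> (v p) \<otimes>\<^bsub>V\<^esub> c h p \<otimes>\<^bsub>V\<^esub> v (\<rho> h (fst p), \<sigma> h (snd p))"
    using I.untwisted by (elim bexE exE conjE)
  note b = this(2)[rule_format] and vb = this(3)[rule_format]
  define U where "U p = v (snd p, fst p)" for p
  have U: "U \<in> ?XY \<rightarrow>\<^sub>M borel_of_topology TV"
    unfolding U_def using measurable_compose[OF mp_map_measurable[OF swap(1)] v] .
  define w0 where "w0 = (\<lambda>(s, g). b (inv\<^bsub>G\<^esub> g) s)"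
  define \<alpha> where "\<alpha> g p = (\<sigma> g (fst p), \<rho> g (snd p))" for g p
  have \<alpha>: "mp_map ?XY ?XY (\<alpha> g)" if "g \<in> carrier G" for g
    unfolding \<alpha>_def using that assms by (intro mp_map_pair mp_action_mp_map)
  have \<alpha>_space: "\<alpha> g p \<in> space ?XY" if "g \<in> carrier G" "p \<in> space ?XY" for g p
    using measurable_space[OF mp_map_measurable[OF \<alpha>]] that .
  have Uco: "AE p in ?XY. w0 (snd p, g) = inv\<^bsub>V\<^esub> (U p) \<otimes>\<^bsub>V\<^esub> w (p, g) \<otimes>\<^bsub>V\<^esub> U (\<alpha> (inv\<^bsub>G\<^esub> g) p)"
    if g: "g \<in> carrier G" for g
    using mp_map_AE[OF swap(1) vb[OF G.inv_closed[OF g]]] by eventually_elim (use g in \<open>simp add: w0_def U_def c_def \<alpha>_def\<close>)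
  have "cohomologous G ?XY ?a V TV w (\<lambda>((t, s), g). w0 (s, g))"
    unfolding cohomologous_def
  proof (intro bexI[OF _ U] ballI)
    fix g assume g: "g \<in> carrier G"
    show "AE t in ?XY. (case (t, g) of (x, xa) \<Rightarrow> (case x of (t, s) \<Rightarrow> \<lambda>g. w0 (s, g)) xa) =
        inv\<^bsub>V\<^esub> (U t) \<otimes>\<^bsub>V\<^esub> w (t, g) \<otimes>\<^bsub>V\<^esub> U (?a (inv\<^bsub>G\<^esub> g) t)"
      using Uco[OF g] AE_space by eventually_elim (simp add: diag_action_apply \<alpha>_def case_prod_beta)
  qed
  moreover have "w0 \<in> cocycles G Y \<rho> V TV"
    unfolding cocycles_def
  proof (intro CollectI conjI ballI)
    show "w0 \<in> Y \<Otimes>\<^sub>M count_space (carrier G) \<rightarrow>\<^sub>M borel_of_topology TV"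
    proof -
      \<comment> \<open>Over a countable group, measurability in the \<open>Y\<close>-variable for
        each fixed element gives joint measurability.\<close>
      have "(\<lambda>q. w0 (snd q, fst q)) \<in> count_space (carrier G) \<Otimes>\<^sub>M Y \<rightarrow>\<^sub>M borel_of_topology TV"
        using b by (intro measurable_pair_measure_countable1 assms(2)) (simp add: w0_def)
      from measurable_compose[OF measurable_pair_swap' this] show ?thesis
        by (simp add: case_prod_beta)
    qed
    fix g h assume g: "g \<in> carrier G" and h: "h \<in> carrier G"
    have inv_gh: "inv\<^bsub>G\<^esub> (g \<otimes>\<^bsub>G\<^esub> h) = inv\<^bsub>G\<^esub> h \<otimes>\<^bsub>G\<^esub> inv\<^bsub>G\<^esub> g" using g h by (rule G.inv_mult_group)
    have "AE p in ?XY. w (p, g) \<otimes>\<^bsub>V\<^esub> w (?a (inv\<^bsub>G\<^esub> g) p, h) = w (p, g \<otimes>\<^bsub>G\<^esub> h)"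
      using w g h by (simp add: cocycles_def)
    then have "AE p in ?XY. w0 (snd p, g) \<otimes>\<^bsub>V\<^esub> w0 (\<rho> (inv\<^bsub>G\<^esub> g) (snd p), h) = w0 (snd p, g \<otimes>\<^bsub>G\<^esub> h)"
      using Uco[OF g] Uco[OF G.m_closed[OF g h]] mp_map_AE[OF \<alpha>[OF G.inv_closed[OF g]] Uco[OF h]] AE_space
    proof eventually_elim
      case (elim p)
      let ?q = "\<alpha> (inv\<^bsub>G\<^esub> g) p"
      have q: "?q \<in> space ?XY" "\<alpha> (inv\<^bsub>G\<^esub> h) ?q \<in> space ?XY" using elim(5) g h by (auto intro!: \<alpha>_space)
      have gh: "\<alpha> (inv\<^bsub>G\<^esub> (g \<otimes>\<^bsub>G\<^esub> h)) p = \<alpha> (inv\<^bsub>G\<^esub> h) ?q"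
        unfolding inv_gh using elim(5) g h
        by (simp add: \<alpha>_def mp_action_compose[OF assms(4)] mp_action_compose[OF assms(7)] space_pair_measure mem_Times_iff)
      have cl: "U p \<in> carrier V" "U ?q \<in> carrier V" "U (\<alpha> (inv\<^bsub>G\<^esub> h) ?q) \<in> carrier V"
          "w (p, g) \<in> carrier V" "w (?q, h) \<in> carrier V"
        using V.measurable_carrier[OF U] V.measurable_carrier[OF wg] q elim(5) g h by auto
      have "w (p, g \<otimes>\<^bsub>G\<^esub> h) = w (p, g) \<otimes>\<^bsub>V\<^esub> w (?q, h)"
        using elim(1,5) by (simp add: diag_action_apply \<alpha>_def)
      moreover have "w0 (\<rho> (inv\<^bsub>G\<^esub> g) (snd p), h) = inv\<^bsub>V\<^esub> (U ?q) \<otimes>\<^bsub>V\<^esub> w (?q, h) \<otimes>\<^bsub>V\<^esub> U (\<alpha> (inv\<^bsub>G\<^esub> h) ?q)"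
        using elim(4) by (simp add: \<alpha>_def)
      ultimately show ?case
        using elim(2,3) cl by (simp add: gh V.m_assoc V.mult_inv_cancel)
    qed
    \<comment> \<open>Both sides involve only the \<open>Y\<close>-coordinate, so the identity
      descends from the product to \<open>Y\<close>.\<close>
    then have "AE p in Y \<Otimes>\<^sub>M X. w0 (fst p, g) \<otimes>\<^bsub>V\<^esub> w0 (\<rho> (inv\<^bsub>G\<^esub> g) (fst p), h) = w0 (fst p, g \<otimes>\<^bsub>G\<^esub> h)"
      using mp_map_AE[OF swap(2), where P = "\<lambda>p. w0 (snd p, g) \<otimes>\<^bsub>V\<^esub> w0 (\<rho> (inv\<^bsub>G\<^esub> g) (snd p), h) = w0 (snd p, g \<otimes>\<^bsub>G\<^esub> h)"]
      by simp
    from AE_fst[OF assms(3) this assms(6)]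
    show "AE t in Y. w0 (t, g) \<otimes>\<^bsub>V\<^esub> w0 (\<rho> (inv\<^bsub>G\<^esub> g) t, h) = w0 (t, g \<otimes>\<^bsub>G\<^esub> h)" .
  qed
  ultimately show ?thesis by blast
qed

section \<open>Group morphisms as cocycles over a one-point space\<close>

lemma mp_action_unit:
  assumes "group G"
  shows "mp_action G (return (count_space UNIV) ()) (\<lambda>g x. x)"
proof -
  have "group_hom G (BijGroup (UNIV :: unit set)) (\<lambda>g x. x)"
    unfolding group_hom_def group_hom_axioms_def
    by (intro conjI assms group_BijGroup)
      (auto simp: hom_def BijGroup_def Bij_def bij_def inj_on_def surj_def)
  then show ?thesis
    using mp_map_id[of "return (count_space UNIV) ()"]
    unfolding mp_action_def group_action_def mp_map_def space_return space_count_space by blast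
qed

text \<open>Over a one-point \<open>Y\<close> a cocycle is a group morphism, so the harder direction
  is an instance of \<open>untwist_of_intertwiner\<close>. The instance has a space of type
  \<open>unit\<close>, whereas the final statement quantifies over spaces of one fixed type
  \<open>'y\<close>; hence the reduction to the lemma.\<close>

lemma cohomologous_morphism_iff:
  fixes G :: "('g, 'r) monoid_scheme" and V :: "('v, 'q) monoid_scheme"
  assumes "group G" "countable (carrier G)"
    and "prob_space X" "mp_action G X \<sigma>" "weakly_mixing G X \<sigma>"
    and "second_countable_group V TV" "biinvariant_group L d"
    and \<phi>: "\<phi> \<in> closed_embedding V TV L (Metric_space.mtopology (carrier L) d)"
    and w: "w \<in> cocycles G X \<sigma> V TV"
  shows "(\<exists>\<theta>\<in>hom G V. cohomologous G X \<sigma> V TV w (\<lambda>(t, g). \<theta> g)) \<longleftrightarrow>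
    cohomologous G (X \<Otimes>\<^sub>M X) (diag_action X \<sigma> X \<sigma>) V TV
      (\<lambda>((t1, t2), g). w (t1, g)) (\<lambda>((t1, t2), g). w (t2, g))" (is "?lhs \<longleftrightarrow> ?rhs")
proof
  interpret G: group G by fact
  interpret V: second_countable_group V TV by fact
  interpret L: biinvariant_group L d by fact
  interpret X: prob_space X by fact
  have wc: "w (p, g) \<in> carrier V" if "g \<in> carrier G" "p \<in> space X" for g p
    using V.measurable_carrier[OF cocycles_measurable[OF w]] that by blast
  {
    assume ?lhs
    then obtain \<theta> where "cohomologous G X \<sigma> V TV w (\<lambda>(t, g). \<theta> g)" by blast
    then have "cohomologous G (X \<Otimes>\<^sub>M X) (diag_action X \<sigma> X \<sigma>) V TV
        (\<lambda>(z, g). w (fst z, g)) (\<lambda>(z, g). w (snd z, g))"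
      by (rule cohomologous_pullback[OF assms(6,1)])
        (use assms(3,4) in \<open>auto simp: wc mp_action_space diag_action_apply mp_map_fst mp_map_snd\<close>)
    then show ?rhs by (simp add: case_prod_beta')
  next
    assume ?rhs
    define Y where "Y = return (count_space UNIV) ()"
    define w' where "w' = (\<lambda>(p :: 'a \<times> unit, g). w (fst p, g))"
    have Y: "prob_space Y" unfolding Y_def by (rule prob_space_return) simp
    have actY: "mp_action G Y (\<lambda>g x. x)" unfolding Y_def using assms(1) by (rule mp_action_unit)
    have XX: "prob_space (X \<Otimes>\<^sub>M X)" using assms(3) by (intro prob_space_pair)
    have w': "w' \<in> cocycles G (X \<Otimes>\<^sub>M Y) (diag_action X \<sigma> Y (\<lambda>g x. x)) V TV"
      unfolding cocycles_def
    proof (intro CollectI conjI ballI)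
      have [measurable]: "w \<in> X \<Otimes>\<^sub>M count_space (carrier G) \<rightarrow>\<^sub>M borel_of_topology TV"
        using w by (simp add: cocycles_def)
      show "w' \<in> (X \<Otimes>\<^sub>M Y) \<Otimes>\<^sub>M count_space (carrier G) \<rightarrow>\<^sub>M borel_of_topology TV"
        unfolding w'_def by measurable
      fix g h assume gh: "g \<in> carrier G" "h \<in> carrier G"
      then have "AE t in X. w (t, g) \<otimes>\<^bsub>V\<^esub> w (\<sigma> (inv\<^bsub>G\<^esub> g) t, h) = w (t, g \<otimes>\<^bsub>G\<^esub> h)"
        using w by (simp add: cocycles_def)
      from mp_map_AE[OF mp_map_fst[OF Y assms(3)] this] AE_space
      show "AE t in X \<Otimes>\<^sub>M Y. w' (t, g) \<otimes>\<^bsub>V\<^esub> w' (diag_action X \<sigma> Y (\<lambda>g x. x) (inv\<^bsub>G\<^esub> g) t, h) = w' (t, g \<otimes>\<^bsub>G\<^esub> h)"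
        by eventually_elim (simp add: w'_def diag_action_apply)
    qed
    obtain u where u: "u \<in> X \<Otimes>\<^sub>M X \<rightarrow>\<^sub>M borel_of_topology TV" and
      uco: "\<forall>g\<in>carrier G. AE z in X \<Otimes>\<^sub>M X. w (snd z, g) =
        inv\<^bsub>V\<^esub> (u z) \<otimes>\<^bsub>V\<^esub> w (fst z, g) \<otimes>\<^bsub>V\<^esub> u (diag_action X \<sigma> X \<sigma> (inv\<^bsub>G\<^esub> g) z)"
      using \<open>?rhs\<close> unfolding cohomologous_def case_prod_beta fst_conv snd_conv by (elim bexE)
    have "group_hom V L \<phi>" using \<phi> by unfold_locales (simp add: closed_embedding_def)
    then interpret \<phi>: group_hom V L \<phi> .
    \<comment> \<open>The transfer function has values in \<open>V\<close>; composing it with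
      \<open>\<phi>\<close> gives an intertwiner in \<open>L\<close>, and the point coordinate is
      ignored.\<close>
    have "cohomologous G ((X \<Otimes>\<^sub>M X) \<Otimes>\<^sub>M Y) (diag_action (X \<Otimes>\<^sub>M X) (diag_action X \<sigma> X \<sigma>) Y (\<lambda>g x. x))
      L L.mtopology
      (\<phi> \<circ> (\<lambda>(((t1, t2), s), g). w' ((t1, s), g))) (\<phi> \<circ> (\<lambda>(((t1, t2), s), g). w' ((t2, s), g)))"
      unfolding cohomologous_def
    proof (intro bexI ballI)
      show "(\<lambda>z. \<phi> (u (fst z))) \<in> (X \<Otimes>\<^sub>M X) \<Otimes>\<^sub>M Y \<rightarrow>\<^sub>M borel_of_topology L.mtopology"
        by (intro measurable_compose[OF _ closed_embedding_measurable[OF \<phi>]] measurable_compose[OF measurable_fst u])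
      fix g assume g: "g \<in> carrier G"
      show "AE z in (X \<Otimes>\<^sub>M X) \<Otimes>\<^sub>M Y. (\<phi> \<circ> (\<lambda>(((t1, t2), s), g). w' ((t2, s), g))) (z, g) =
        inv\<^bsub>L\<^esub> \<phi> (u (fst z)) \<otimes>\<^bsub>L\<^esub> (\<phi> \<circ> (\<lambda>(((t1, t2), s), g). w' ((t1, s), g))) (z, g) \<otimes>\<^bsub>L\<^esub>
          \<phi> (u (fst (diag_action (X \<Otimes>\<^sub>M X) (diag_action X \<sigma> X \<sigma>) Y (\<lambda>g x. x) (inv\<^bsub>G\<^esub> g) z)))"
        using mp_map_AE[OF mp_map_fst[OF Y XX] bspec[OF uco g]] AE_space
      proof eventually_elim
        case (elim z)
        obtain t1 t2 where z: "z = ((t1, t2), ())" "t1 \<in> space X" "t2 \<in> space X"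
          using elim(2) by (cases z) (auto simp: space_pair_measure)
        have z2: "(t1, t2) \<in> space (X \<Otimes>\<^sub>M X)" "((t1, t2), ()) \<in> space ((X \<Otimes>\<^sub>M X) \<Otimes>\<^sub>M Y)"
          using elim(2) z by (auto simp: space_pair_measure)
        have "(\<sigma> (inv\<^bsub>G\<^esub> g) t1, \<sigma> (inv\<^bsub>G\<^esub> g) t2) \<in> space (X \<Otimes>\<^sub>M X)"
          using z g mp_action_space[OF assms(4)] by (simp add: space_pair_measure)
        then have "u (t1, t2) \<in> carrier V" "u (\<sigma> (inv\<^bsub>G\<^esub> g) t1, \<sigma> (inv\<^bsub>G\<^esub> g) t2) \<in> carrier V" "w (t1, g) \<in> carrier V"
          using V.measurable_carrier[OF u] z2(1) wc[OF g z(2)] by blast+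
        then show ?case using elim(1) z z2 by (simp add: w'_def diag_action_apply)
      qed
    qed
    from untwist_of_intertwiner[OF assms(1-5) Y actY assms(6-7) \<phi> w' this]
    obtain w0 where w0: "w0 \<in> cocycles G Y (\<lambda>g x. x) V TV" and
      co: "cohomologous G (X \<Otimes>\<^sub>M Y) (diag_action X \<sigma> Y (\<lambda>g x. x)) V TV w' (\<lambda>((t, s), g). w0 (s, g))"
      by (elim bexE)
    define \<theta> where "\<theta> g = w0 ((), g)" for g
    have sY: "() \<in> space Y" by (simp add: Y_def)
    have "\<theta> \<in> hom G V"
    proof (rule homI)
      show "\<theta> g \<in> carrier V" if "g \<in> carrier G" for g
        unfolding \<theta>_def using V.measurable_carrier[OF cocycles_measurable[OF w0 that] sY] .
      fix g h assume "g \<in> carrier G" "h \<in> carrier G"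
      then have "AE t in Y. w0 (t, g) \<otimes>\<^bsub>V\<^esub> w0 (t, h) = w0 (t, g \<otimes>\<^bsub>G\<^esub> h)"
        using w0 by (simp add: cocycles_def)
      \<comment> \<open>An almost sure identity holds at some point, and the only point is
        \<open>()\<close>.\<close>
      from AE_ex[OF Y this] show "\<theta> (g \<otimes>\<^bsub>G\<^esub> h) = \<theta> g \<otimes>\<^bsub>V\<^esub> \<theta> h"
        unfolding \<theta>_def by (metis (full_types) old.unit.exhaust)
    qed
    moreover have "cohomologous G X \<sigma> V TV w (\<lambda>(t, g). \<theta> g)"
    proof -
      obtain v where v: "v \<in> X \<Otimes>\<^sub>M Y \<rightarrow>\<^sub>M borel_of_topology TV" and
        vco: "\<forall>g\<in>carrier G. AE p in X \<Otimes>\<^sub>M Y. \<theta> g =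
          inv\<^bsub>V\<^esub> (v p) \<otimes>\<^bsub>V\<^esub> w (fst p, g) \<otimes>\<^bsub>V\<^esub> v (diag_action X \<sigma> Y (\<lambda>g x. x) (inv\<^bsub>G\<^esub> g) p)"
        using co unfolding cohomologous_def case_prod_beta fst_conv snd_conv w'_def \<theta>_def
        by (elim bexE) simp
      have "(\<lambda>t. v (t, ())) \<in> X \<rightarrow>\<^sub>M borel_of_topology TV"
        using measurable_compose[OF measurable_Pair2'[OF sY] v] .
      moreover have "AE t in X. \<theta> g = inv\<^bsub>V\<^esub> (v (t, ())) \<otimes>\<^bsub>V\<^esub> w (t, g) \<otimes>\<^bsub>V\<^esub> v (\<sigma> (inv\<^bsub>G\<^esub> g) t, ())"
        if g: "g \<in> carrier G" for g
      proof (rule AE_fst[OF Y _ assms(3)])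
        show "AE p in X \<Otimes>\<^sub>M Y. \<theta> g = inv\<^bsub>V\<^esub> (v (fst p, ())) \<otimes>\<^bsub>V\<^esub> w (fst p, g) \<otimes>\<^bsub>V\<^esub> v (\<sigma> (inv\<^bsub>G\<^esub> g) (fst p), ())"
          using bspec[OF vco g] AE_space by eventually_elim (auto simp: diag_action_apply)
      qed
      ultimately show ?thesis unfolding cohomologous_def by (intro bexI[of _ "\<lambda>t. v (t, ())"]) auto
    qed
    ultimately show ?lhs by blast
  }
qed

theorem theorem3p1:
  fixes G :: "'g monoid" and V :: "'v monoid" and TV :: "'v topology"
    and X :: "'x measure" and \<sigma> :: "'g \<Rightarrow> 'x \<Rightarrow> 'x"
  defines "XX \<equiv> X \<Otimes>\<^sub>M X" and "\<sigma>2 \<equiv> diag_action X \<sigma> X \<sigma>"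
  assumes "group G" and "countable (carrier G)"
    and "standard_prob_space X" and "mp_action G X \<sigma>" and "weakly_mixing G X \<sigma>"
    and "polish_group V TV" and "finite_type TYPE('h::complex_hilbert) V TV"
  shows
    "(\<forall>(Y :: 'y measure) \<rho>. standard_prob_space Y \<and> mp_action G Y \<rho> \<longrightarrow>
       (\<forall>w \<in> cocycles G (X \<Otimes>\<^sub>M Y) (diag_action X \<sigma> Y \<rho>) V TV.
          let wl = (\<lambda>(((t1, t2), s), g). w ((t1, s), g));
              wr = (\<lambda>(((t1, t2), s), g). w ((t2, s), g));
              untwists = (\<exists>w0 \<in> cocycles G Y \<rho> V TV.
                 cohomologous G (X \<Otimes>\<^sub>M Y) (diag_action X \<sigma> Y \<rho>) V TV
                   w (\<lambda>((t, s), g). w0 (s, g)))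
          in
            ((\<exists>(N :: ('h \<Rightarrow>\<^sub>L 'h) set) \<tau>. separable_finite_vN N \<tau> \<and>
                (\<exists>\<phi> \<in> closed_embedding V TV (unitary_group N) (unitary_topology N \<tau>).
                   cohomologous G (XX \<Otimes>\<^sub>M Y) (diag_action XX \<sigma>2 Y \<rho>)
                     (unitary_group N) (unitary_topology N \<tau>) (\<phi> \<circ> wl) (\<phi> \<circ> wr)))
              \<longrightarrow> untwists) \<and>
            (untwists \<longrightarrow>
               cohomologous G (XX \<Otimes>\<^sub>M Y) (diag_action XX \<sigma>2 Y \<rho>) V TV wl wr))) \<and>
     (\<forall>w \<in> cocycles G X \<sigma> V TV.
        (\<exists>\<theta> \<in> hom G V. cohomologous G X \<sigma> V TV w (\<lambda>(t, g). \<theta> g)) \<longleftrightarrow>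
        cohomologous G XX \<sigma>2 V TV
          (\<lambda>((t1, t2), g). w (t1, g)) (\<lambda>((t1, t2), g). w (t2, g)))"
proof -
  have X: "prob_space X" using \<open>standard_prob_space X\<close> by (simp add: standard_prob_space_def)
  have XX: "prob_space XX" unfolding XX_def using X by (intro prob_space_pair)
  have V: "second_countable_group V TV"
    using \<open>polish_group V TV\<close> by (rule polish_group_second_countable_group)
  interpret V: second_countable_group V TV by (rule V)
  note hyps = \<open>group G\<close> \<open>countable (carrier G)\<close> X \<open>mp_action G X \<sigma>\<close> \<open>weakly_mixing G X \<sigma>\<close>
  have product: "((\<exists>(N :: ('h \<Rightarrow>\<^sub>L 'h) set) \<tau>. separable_finite_vN N \<tau> \<and>
        (\<exists>\<phi> \<in> closed_embedding V TV (unitary_group N) (unitary_topology N \<tau>).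
           cohomologous G (XX \<Otimes>\<^sub>M Y) (diag_action XX \<sigma>2 Y \<rho>)
             (unitary_group N) (unitary_topology N \<tau>)
             (\<phi> \<circ> (\<lambda>(((t1, t2), s), g). w ((t1, s), g))) (\<phi> \<circ> (\<lambda>(((t1, t2), s), g). w ((t2, s), g)))))
      \<longrightarrow> (\<exists>w0 \<in> cocycles G Y \<rho> V TV.
         cohomologous G (X \<Otimes>\<^sub>M Y) (diag_action X \<sigma> Y \<rho>) V TV w (\<lambda>((t, s), g). w0 (s, g)))) \<and>
    ((\<exists>w0 \<in> cocycles G Y \<rho> V TV.
         cohomologous G (X \<Otimes>\<^sub>M Y) (diag_action X \<sigma> Y \<rho>) V TV w (\<lambda>((t, s), g). w0 (s, g)))
      \<longrightarrow> cohomologous G (XX \<Otimes>\<^sub>M Y) (diag_action XX \<sigma>2 Y \<rho>) V TV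
        (\<lambda>(((t1, t2), s), g). w ((t1, s), g)) (\<lambda>(((t1, t2), s), g). w ((t2, s), g)))"
    if "standard_prob_space Y" and actY: "mp_action G Y \<rho>"
      and w: "w \<in> cocycles G (X \<Otimes>\<^sub>M Y) (diag_action X \<sigma> Y \<rho>) V TV"
    for Y :: "'y measure" and \<rho> w
  proof (intro conjI impI; elim exE bexE conjE)
    have Y: "prob_space Y" using \<open>standard_prob_space Y\<close> by (simp add: standard_prob_space_def)
    {
      fix N :: "('h \<Rightarrow>\<^sub>L 'h) set" and \<tau> \<phi>
      assume N: "separable_finite_vN N \<tau>"
        and \<phi>: "\<phi> \<in> closed_embedding V TV (unitary_group N) (unitary_topology N \<tau>)"
        and co: "cohomologous G (XX \<Otimes>\<^sub>M Y) (diag_action XX \<sigma>2 Y \<rho>)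
           (unitary_group N) (unitary_topology N \<tau>)
           (\<phi> \<circ> (\<lambda>(((t1, t2), s), g). w ((t1, s), g))) (\<phi> \<circ> (\<lambda>(((t1, t2), s), g). w ((t2, s), g)))"
      show "\<exists>w0 \<in> cocycles G Y \<rho> V TV.
         cohomologous G (X \<Otimes>\<^sub>M Y) (diag_action X \<sigma> Y \<rho>) V TV w (\<lambda>((t, s), g). w0 (s, g))"
        by (rule untwist_of_intertwiner[OF hyps Y actY V
              finite_vN.biinvariant_unitary_group[OF finite_vN.intro[OF N]]
              \<phi>[unfolded unitary_topology_def] w co[unfolded unitary_topology_def XX_def \<sigma>2_def]])
    next
      fix w0
      assume co: "cohomologous G (X \<Otimes>\<^sub>M Y) (diag_action X \<sigma> Y \<rho>) V TV w (\<lambda>((t, s), g). w0 (s, g))"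
      have "cohomologous G (XX \<Otimes>\<^sub>M Y) (diag_action XX \<sigma>2 Y \<rho>) V TV
          (\<lambda>(z, g). w ((fst (fst z), snd z), g)) (\<lambda>(z, g). w ((snd (fst z), snd z), g))"
        using V hyps(1) co
      proof (rule cohomologous_pullback)
        show "w (p, g) \<in> carrier V" if "g \<in> carrier G" "p \<in> space (X \<Otimes>\<^sub>M Y)" for g p
          using V.measurable_carrier[OF cocycles_measurable[OF w]] that by blast
        show "diag_action X \<sigma> Y \<rho> g p \<in> space (X \<Otimes>\<^sub>M Y)" if "g \<in> carrier G" "p \<in> space (X \<Otimes>\<^sub>M Y)" for g p
          using that mp_action_space[OF hyps(4)] mp_action_space[OF actY]
          by (auto simp: diag_action_apply space_pair_measure)
        show "mp_map (XX \<Otimes>\<^sub>M Y) (X \<Otimes>\<^sub>M Y) (\<lambda>z. (fst (fst z), snd z))"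
          "mp_map (XX \<Otimes>\<^sub>M Y) (X \<Otimes>\<^sub>M Y) (\<lambda>z. (snd (fst z), snd z))"
          unfolding XX_def using mp_map_under[OF mp_map_fst[OF X X] X Y] mp_map_under[OF mp_map_snd[OF X X] X Y] .
      qed (auto simp: diag_action_apply XX_def \<sigma>2_def space_pair_measure)
      then show "cohomologous G (XX \<Otimes>\<^sub>M Y) (diag_action XX \<sigma>2 Y \<rho>) V TV
        (\<lambda>(((t1, t2), s), g). w ((t1, s), g)) (\<lambda>(((t1, t2), s), g). w ((t2, s), g))"
        by (simp add: case_prod_beta')
    }
  qed
  \<comment> \<open>In the product statement the algebra comes with the intertwiner. For morphisms
    the equivalence is given in \<open>V\<close> itself, so the finite type of \<open>V\<close> has
    to provide an algebra and an embedding.\<close>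
  obtain N :: "('h \<Rightarrow>\<^sub>L 'h) set" and \<tau> \<phi> where N: "separable_finite_vN N \<tau>"
    and \<phi>: "\<phi> \<in> closed_embedding V TV (unitary_group N) (unitary_topology N \<tau>)"
    using \<open>finite_type TYPE('h::complex_hilbert) V TV\<close> unfolding finite_type_def by auto
  have morphism: "(\<exists>\<theta> \<in> hom G V. cohomologous G X \<sigma> V TV w (\<lambda>(t, g). \<theta> g)) \<longleftrightarrow>
      cohomologous G XX \<sigma>2 V TV
        (\<lambda>((t1, t2), g). w (t1, g)) (\<lambda>((t1, t2), g). w (t2, g))"
    if "w \<in> cocycles G X \<sigma> V TV" for w
    unfolding XX_def \<sigma>2_def
    by (rule cohomologous_morphism_iff[OF hyps V
          finite_vN.biinvariant_unitary_group[OF finite_vN.intro[OF N]]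
          \<phi>[unfolded unitary_topology_def] that])
  show ?thesis
    unfolding Let_def
    by (rule conjI; intro allI impI ballI) (elim conjE, rule product, assumption+, rule morphism)
qed

end
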